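(* Let $G$ be a surjunctive group and let $k$ be a field. Then for every integer $n \geq 1$, the matrix ring $\mathrm{Mat}_n(k[G])$ is directly finite (that is, Kaplansky's stable finiteness conjecture holds for $G$ and $k$). In particular, Gottschalk's conjecture implies Kaplansky's stable finiteness conjecture: if every group is surjunctive, then for every group $G$, every field $k$ and every $n \geq 1$, the ring $\mathrm{Mat}_n(k[G])$ is directly finite.
   Context: Here $k[G]$ is the group ring and $\mathrm{Mat}_n(k[G])$ is the ring of $n \times n$ matrices with coefficients in $k[G]$. A ring $S$ is directly finite if for all $a,b \in S$, $ab = 1$ implies $ba = 1$. Kaplansky's stable finiteness conjecture for a field $k$ and a group $G$ states that $\mathrm{Mat}_n(k[G])$ is directly finite for every $n \geq 1$. For a set $A$ and a group $G$, $A^G$ is the set of maps $c \colon G \to A$, with the action of $G$ given by $(gc)(h) = c(g^{-1}h)$. A cellular automaton over the group $G$ and the alphabet $A$ is a map $\tau \colon A^G \to A^G$ for which there exist a finite subset $M \subset G$ (a memory set) and a map $\mu \colon A^M \to A$ (a local defining map) such that $(\tau(c))(g) = \mu((g^{-1}c)|_M)$ for all $c \in A^G$ and $g \in G$. A group $G$ is surjunctive if for every finite set $A$, every injective cellular automaton $\tau \colon A^G \to A^G$ is surjective. Gottschalk's conjecture asserts that every group is surjunctive. *)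

theory Defs
  imports "HOL-Algebra.Algebra"
begin

text \<open>
  Groups and fields are the carrier-based structures of HOL-Algebra, so that ``every group'' can be
  quantified over inside a formula.  Maps out of a set are extensional functions, so that equality
  of configurations, group ring elements and matrices is equality in HOL.
\<close>

definition configs :: "('g, 'm) monoid_scheme \<Rightarrow> 'a set \<Rightarrow> ('g \<Rightarrow> 'a) set" where
  "configs G A = carrier G \<rightarrow>\<^sub>E A"

definition shift :: "('g, 'm) monoid_scheme \<Rightarrow> 'g \<Rightarrow> ('g \<Rightarrow> 'a) \<Rightarrow> ('g \<Rightarrow> 'a)" where
  "shift G g c = (\<lambda>h\<in>carrier G. c (inv\<^bsub>G\<^esub> g \<otimes>\<^bsub>G\<^esub> h))"

definition cellular_automaton ::
    "('g, 'm) monoid_scheme \<Rightarrow> 'a set \<Rightarrow> (('g \<Rightarrow> 'a) \<Rightarrow> ('g \<Rightarrow> 'a)) \<Rightarrow> bool" where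
  "cellular_automaton G A \<tau> \<longleftrightarrow>
     \<tau> \<in> configs G A \<rightarrow> configs G A \<and>
     (\<exists>M \<mu>. finite M \<and> M \<subseteq> carrier G \<and> \<mu> \<in> (M \<rightarrow>\<^sub>E A) \<rightarrow> A \<and>
        (\<forall>c\<in>configs G A. \<forall>g\<in>carrier G.
           \<tau> c g = \<mu> (restrict (shift G (inv\<^bsub>G\<^esub> g) c) M)))"

text \<open>
  A definition cannot quantify over the type of the alphabet.  The finite alphabets below are sets
  of natural numbers; lemma \<open>surjunctive_alphabet\<close> shows that the property then holds for finite
  alphabets in any type.
\<close>

definition surjunctive :: "('g, 'm) monoid_scheme \<Rightarrow> bool" where
  "surjunctive G \<longleftrightarrow>
     (\<forall>A :: nat set. finite A \<longrightarrow>
        (\<forall>\<tau>. cellular_automaton G A \<tau> \<and> inj_on \<tau> (configs G A) \<longrightarrow>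
             \<tau> ` configs G A = configs G A))"

lemma surjunctive_alphabet:
  fixes G :: "('g, 'm) monoid_scheme" and A :: "'a set"
  assumes G: "group G" and S: "surjunctive G" and A: "finite A"
    and ca: "cellular_automaton G A \<tau>" and inj: "inj_on \<tau> (configs G A)"
  shows "\<tau> ` configs G A = configs G A"
proof -
  interpret group G by (rule G)
  obtain f where f: "bij_betw f A {..<card A}"
    using ex_bij_betw_finite_nat[OF A] by (auto simp: atLeast0LessThan)
  define B where "B = {..<card A}"
  define p where "p = inv_into A f"
  have fA: "f a \<in> B" if "a \<in> A" for a using f that by (auto simp: B_def bij_betw_def)
  have pB: "p b \<in> A" if "b \<in> B" for b
    using f that unfolding p_def B_def by (metis bij_betw_def inv_into_into)
  have pf: "p (f a) = a" if "a \<in> A" for a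
    using f that by (simp add: p_def bij_betw_inv_into_left)
  have fp: "f (p b) = b" if "b \<in> B" for b
    using f that by (simp add: p_def B_def bij_betw_inv_into_right)
  define F where "F c = (\<lambda>g\<in>carrier G. f (c g))" for c :: "'g \<Rightarrow> 'a"
  define P where "P d = (\<lambda>g\<in>carrier G. p (d g))" for d :: "'g \<Rightarrow> nat"
  have F: "F c \<in> configs G B" if "c \<in> configs G A" for c
    using that fA by (auto simp: F_def configs_def)
  have P: "P d \<in> configs G A" if "d \<in> configs G B" for d
    using that pB by (auto simp: P_def configs_def)
  have PF: "P (F c) = c" if "c \<in> configs G A" for c
  proof
    fix x show "P (F c) x = c x"
      using that pf by (cases "x \<in> carrier G") (auto simp: P_def F_def configs_def PiE_def extensional_def)
  qed
  have FP: "F (P d) = d" if "d \<in> configs G B" for d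
  proof
    fix x show "F (P d) x = d x"
      using that fp by (cases "x \<in> carrier G") (auto simp: P_def F_def configs_def PiE_def extensional_def)
  qed
  define \<sigma> where "\<sigma> d = F (\<tau> (P d))" for d
  have \<tau>: "\<tau> c \<in> configs G A" if "c \<in> configs G A" for c
    using ca that by (auto simp: cellular_automaton_def)
  have \<sigma>: "\<sigma> d \<in> configs G B" if "d \<in> configs G B" for d
    using that by (simp add: \<sigma>_def F P \<tau>)
  obtain M \<mu> where M: "finite M" "M \<subseteq> carrier G" and \<mu>: "\<mu> \<in> (M \<rightarrow>\<^sub>E A) \<rightarrow> A"
    and loc: "\<And>c g. \<lbrakk>c \<in> configs G A; g \<in> carrier G\<rbrakk> \<Longrightarrow>
                \<tau> c g = \<mu> (restrict (shift G (inv\<^bsub>G\<^esub> g) c) M)"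
    using ca unfolding cellular_automaton_def by blast
  define \<nu> where "\<nu> w = f (\<mu> (\<lambda>m\<in>M. p (w m)))" for w
  have "\<nu> \<in> (M \<rightarrow>\<^sub>E B) \<rightarrow> B"
  proof
    fix w assume "w \<in> M \<rightarrow>\<^sub>E B"
    then have "(\<lambda>m\<in>M. p (w m)) \<in> M \<rightarrow>\<^sub>E A" using pB by auto
    then have "\<mu> (\<lambda>m\<in>M. p (w m)) \<in> A" by (rule funcset_mem[OF \<mu>])
    then show "\<nu> w \<in> B" by (simp add: \<nu>_def fA)
  qed
  moreover have "\<sigma> d g = \<nu> (restrict (shift G (inv\<^bsub>G\<^esub> g) d) M)"
    if d: "d \<in> configs G B" and g: "g \<in> carrier G" for d g
  proof -
    have "restrict (shift G (inv\<^bsub>G\<^esub> g) (P d)) M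
        = (\<lambda>m\<in>M. p (restrict (shift G (inv\<^bsub>G\<^esub> g) d) M m))"
      using M g by (auto simp: shift_def P_def fun_eq_iff)
    then show ?thesis using loc[OF P[OF d] g] g by (simp add: \<sigma>_def F_def \<nu>_def)
  qed
  ultimately have "cellular_automaton G B \<sigma>"
    unfolding cellular_automaton_def using M \<sigma> by blast
  moreover have "inj_on \<sigma> (configs G B)"
  proof (rule inj_onI)
    fix d e assume d: "d \<in> configs G B" and e: "e \<in> configs G B" and "\<sigma> d = \<sigma> e"
    then have "\<tau> (P d) = \<tau> (P e)" unfolding \<sigma>_def by (metis PF P \<tau>)
    then have "P d = P e" using inj P[OF d] P[OF e] by (auto dest: inj_onD)
    then show "d = e" by (metis FP d e)
  qed
  ultimately have surj: "\<sigma> ` configs G B = configs G B"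
    using S by (auto simp: surjunctive_def B_def)
  show ?thesis
  proof
    show "\<tau> ` configs G A \<subseteq> configs G A" using \<tau> by blast
    show "configs G A \<subseteq> \<tau> ` configs G A"
    proof
      fix c assume c: "c \<in> configs G A"
      then have "F c \<in> \<sigma> ` configs G B" using F surj by blast
      then obtain d where d: "d \<in> configs G B" "F c = \<sigma> d" by blast
      then have "c = \<tau> (P d)" unfolding \<sigma>_def by (metis PF P \<tau> c)
      then show "c \<in> \<tau> ` configs G A" using P d by blast
    qed
  qed
qed


definition directly_finite :: "('a, 'm) ring_scheme \<Rightarrow> bool" where
  "directly_finite S \<longleftrightarrow>
     (\<forall>a\<in>carrier S. \<forall>b\<in>carrier S. a \<otimes>\<^bsub>S\<^esub> b = \<one>\<^bsub>S\<^esub> \<longrightarrow> b \<otimes>\<^bsub>S\<^esub> a = \<one>\<^bsub>S\<^esub>)"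

text \<open>
  In the convolution \<open>u * v\<close> the term at \<open>h\<close> vanishes outside the support of \<open>u\<close>, so the sum is
  restricted to that (finite) set.
\<close>

definition gsupp :: "('k, 'n) ring_scheme \<Rightarrow> ('g, 'm) monoid_scheme \<Rightarrow> ('g \<Rightarrow> 'k) \<Rightarrow> 'g set" where
  "gsupp k G u = {g \<in> carrier G. u g \<noteq> \<zero>\<^bsub>k\<^esub>}"

definition group_ring :: "('k, 'n) ring_scheme \<Rightarrow> ('g, 'm) monoid_scheme \<Rightarrow> ('g \<Rightarrow> 'k) ring" where
  "group_ring k G =
    \<lparr>carrier = {u \<in> carrier G \<rightarrow>\<^sub>E carrier k. finite (gsupp k G u)},
     monoid.mult = (\<lambda>u v. \<lambda>g\<in>carrier G. \<Oplus>\<^bsub>k\<^esub>h\<in>gsupp k G u. u h \<otimes>\<^bsub>k\<^esub> v (inv\<^bsub>G\<^esub> h \<otimes>\<^bsub>G\<^esub> g)),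
     one = (\<lambda>g\<in>carrier G. if g = \<one>\<^bsub>G\<^esub> then \<one>\<^bsub>k\<^esub> else \<zero>\<^bsub>k\<^esub>),
     ring.zero = (\<lambda>g\<in>carrier G. \<zero>\<^bsub>k\<^esub>),
     ring.add = (\<lambda>u v. \<lambda>g\<in>carrier G. u g \<oplus>\<^bsub>k\<^esub> v g)\<rparr>"

definition mat_ring :: "nat \<Rightarrow> ('r, 'm) ring_scheme \<Rightarrow> (nat \<times> nat \<Rightarrow> 'r) ring" where
  "mat_ring n R =
    \<lparr>carrier = {..<n} \<times> {..<n} \<rightarrow>\<^sub>E carrier R,
     monoid.mult = (\<lambda>a b. \<lambda>(i, j)\<in>{..<n} \<times> {..<n}. \<Oplus>\<^bsub>R\<^esub>l\<in>{..<n}. a (i, l) \<otimes>\<^bsub>R\<^esub> b (l, j)),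
     one = (\<lambda>(i, j)\<in>{..<n} \<times> {..<n}. if i = j then \<one>\<^bsub>R\<^esub> else \<zero>\<^bsub>R\<^esub>),
     ring.zero = (\<lambda>_\<in>{..<n} \<times> {..<n}. \<zero>\<^bsub>R\<^esub>),
     ring.add = (\<lambda>a b. \<lambda>p\<in>{..<n} \<times> {..<n}. a p \<oplus>\<^bsub>R\<^esub> b p)\<rparr>"

lemma (in abelian_monoid) finsum_swap:
  assumes "finite A" "finite B" "\<And>a b. a \<in> A \<Longrightarrow> b \<in> B \<Longrightarrow> f a b \<in> carrier G"
  shows "(\<Oplus>a\<in>A. \<Oplus>b\<in>B. f a b) = (\<Oplus>b\<in>B. \<Oplus>a\<in>A. f a b)"
  using assms(1,3)
proof (induction A)
  case empty then show ?case by (simp add: finsum_zero)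
next
  case (insert x F)
  have "(\<Oplus>b\<in>B. \<Oplus>a\<in>insert x F. f a b) = (\<Oplus>b\<in>B. f x b \<oplus> (\<Oplus>a\<in>F. f a b))"
    using insert by (intro add.finprod_cong') (auto intro!: finsum_insert finsum_closed)
  also have "\<dots> = (\<Oplus>b\<in>B. f x b) \<oplus> (\<Oplus>b\<in>B. \<Oplus>a\<in>F. f a b)"
    using insert by (intro finsum_addf) (auto intro!: finsum_closed)
  finally show ?case using insert by (auto simp: Pi_def intro!: finsum_insert[THEN trans] finsum_closed)
qed

lemma (in abelian_monoid) finsum_delta:
  assumes "finite A" "i \<in> A" "x \<in> carrier G" "\<And>a. a \<in> A \<Longrightarrow> f a = (if a = i then x else \<zero>)"
  shows "(\<Oplus>a\<in>A. f a) = x"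
proof -
  have "(\<Oplus>a\<in>A. f a) = (\<Oplus>a\<in>A. if a = i then x else \<zero>)"
    using assms by (intro add.finprod_cong') auto
  also have "\<dots> = (\<Oplus>a\<in>A. if i = a then x else \<zero>)" by (metis)
  also have "\<dots> = x" using add.finprod_singleton[of i A "\<lambda>_. x"] assms by auto
  finally show ?thesis .
qed

lemma ring_mat_ring:
  fixes R (structure)
  assumes "ring R"
  shows "ring (mat_ring n R)"
proof -
  interpret ring R by fact
  let ?M = "mat_ring n R"
  let ?N = "{..<n}"
  have cl: "a (i, j) \<in> carrier R" if "a \<in> carrier ?M" "i < n" "j < n" for a i j
    using that by (auto simp: mat_ring_def)
  have ext: "a \<in> extensional (?N \<times> ?N)" if "a \<in> carrier ?M" for a
    using that by (auto simp: mat_ring_def PiE_def)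
  have CI: "a \<in> carrier ?M"
    if "a \<in> extensional (?N \<times> ?N)" "\<And>i j. \<lbrakk>i < n; j < n\<rbrakk> \<Longrightarrow> a (i, j) \<in> carrier R" for a
    using that by (auto simp: mat_ring_def PiE_def)
  have eqI: "a = b"
    if "a \<in> carrier ?M" "b \<in> carrier ?M" "\<And>i j. \<lbrakk>i < n; j < n\<rbrakk> \<Longrightarrow> a (i, j) = b (i, j)" for a b
    using ext[OF that(1)] ext[OF that(2)] by (rule extensionalityI) (use that(3) in auto)
  have add: "(a \<oplus>\<^bsub>?M\<^esub> b) (i, j) = a (i, j) \<oplus> b (i, j)" if "i < n" "j < n" for a b i j
    using that by (simp add: mat_ring_def)
  have zero: "\<zero>\<^bsub>?M\<^esub> (i, j) = \<zero>" if "i < n" "j < n" for i j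
    using that by (simp add: mat_ring_def)
  have one: "\<one>\<^bsub>?M\<^esub> (i, j) = (if i = j then \<one> else \<zero>)" if "i < n" "j < n" for i j
    using that by (simp add: mat_ring_def)
  have mult: "(a \<otimes>\<^bsub>?M\<^esub> b) (i, j) = (\<Oplus>l\<in>?N. a (i, l) \<otimes> b (l, j))" if "i < n" "j < n" for a b i j
    using that by (simp add: mat_ring_def)
  have addC: "a \<oplus>\<^bsub>?M\<^esub> b \<in> carrier ?M" if "a \<in> carrier ?M" "b \<in> carrier ?M" for a b
    by (rule CI) (simp add: mat_ring_def, simp add: add cl that)
  have zC: "\<zero>\<^bsub>?M\<^esub> \<in> carrier ?M"
    by (rule CI) (simp add: mat_ring_def, simp add: zero)
  have oC: "\<one>\<^bsub>?M\<^esub> \<in> carrier ?M"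
    by (rule CI) (simp add: mat_ring_def, simp add: one)
  have mC: "a \<otimes>\<^bsub>?M\<^esub> b \<in> carrier ?M" if "a \<in> carrier ?M" "b \<in> carrier ?M" for a b
    by (rule CI) (simp add: mat_ring_def, auto simp: mult cl that intro!: finsum_closed)
  show ?thesis
  proof (rule ringI)
    show "abelian_group ?M"
    proof (rule abelian_groupI)
      fix x assume x: "x \<in> carrier ?M"
      let ?y = "\<lambda>p\<in>?N \<times> ?N. \<ominus> x p"
      have y: "?y \<in> carrier ?M" by (rule CI) (auto simp: cl x)
      have "?y \<oplus>\<^bsub>?M\<^esub> x = \<zero>\<^bsub>?M\<^esub>"
        by (rule eqI) (simp_all add: addC zC x y add zero cl l_neg)
      then show "\<exists>y\<in>carrier ?M. y \<oplus>\<^bsub>?M\<^esub> x = \<zero>\<^bsub>?M\<^esub>" using y by blast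
    next
      fix x y assume "x \<in> carrier ?M" "y \<in> carrier ?M"
      then show "x \<oplus>\<^bsub>?M\<^esub> y = y \<oplus>\<^bsub>?M\<^esub> x"
        by (intro eqI) (simp_all add: addC add cl a_comm)
    next
      fix x y z assume "x \<in> carrier ?M" "y \<in> carrier ?M" "z \<in> carrier ?M"
      then show "x \<oplus>\<^bsub>?M\<^esub> y \<oplus>\<^bsub>?M\<^esub> z = x \<oplus>\<^bsub>?M\<^esub> (y \<oplus>\<^bsub>?M\<^esub> z)"
        by (intro eqI) (simp_all add: addC add cl a_assoc)
    next
      fix x assume "x \<in> carrier ?M"
      then show "\<zero>\<^bsub>?M\<^esub> \<oplus>\<^bsub>?M\<^esub> x = x"
        by (intro eqI) (simp_all add: addC zC add zero cl)
    qed (simp_all add: addC zC)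
    show "monoid ?M"
    proof (rule monoidI)
      fix x y z assume x: "x \<in> carrier ?M" and y: "y \<in> carrier ?M" and z: "z \<in> carrier ?M"
      show "x \<otimes>\<^bsub>?M\<^esub> y \<otimes>\<^bsub>?M\<^esub> z = x \<otimes>\<^bsub>?M\<^esub> (y \<otimes>\<^bsub>?M\<^esub> z)"
      proof (rule eqI)
        fix i j assume ij: "i < n" "j < n"
        have "(x \<otimes>\<^bsub>?M\<^esub> y \<otimes>\<^bsub>?M\<^esub> z) (i, j) = (\<Oplus>l\<in>?N. (x \<otimes>\<^bsub>?M\<^esub> y) (i, l) \<otimes> z (l, j))"
          using ij by (rule mult)
        also have "\<dots> = (\<Oplus>l\<in>?N. \<Oplus>m\<in>?N. x (i, m) \<otimes> (y (m, l) \<otimes> z (l, j)))"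
        proof (rule finsum_cong'[OF refl])
          fix l assume "l \<in> ?N"
          then have l: "l < n" by simp
          have "(x \<otimes>\<^bsub>?M\<^esub> y) (i, l) \<otimes> z (l, j) = (\<Oplus>m\<in>?N. x (i, m) \<otimes> y (m, l)) \<otimes> z (l, j)"
            using ij l by (simp add: mult)
          also have "\<dots> = (\<Oplus>m\<in>?N. (x (i, m) \<otimes> y (m, l)) \<otimes> z (l, j))"
            using ij l x y z cl by (intro finsum_ldistr) auto
          also have "\<dots> = (\<Oplus>m\<in>?N. x (i, m) \<otimes> (y (m, l) \<otimes> z (l, j)))"
            using ij l x y z cl by (intro finsum_cong') (auto simp: m_assoc)
          finally show "(x \<otimes>\<^bsub>?M\<^esub> y) (i, l) \<otimes> z (l, j)
            = (\<Oplus>m\<in>?N. x (i, m) \<otimes> (y (m, l) \<otimes> z (l, j)))" .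
        qed (use ij x y z cl in \<open>auto intro!: finsum_closed\<close>)
        also have "\<dots> = (\<Oplus>m\<in>?N. \<Oplus>l\<in>?N. x (i, m) \<otimes> (y (m, l) \<otimes> z (l, j)))"
          using ij x y z cl by (intro finsum_swap) auto
        also have "\<dots> = (\<Oplus>m\<in>?N. x (i, m) \<otimes> (y \<otimes>\<^bsub>?M\<^esub> z) (m, j))"
        proof (rule finsum_cong'[OF refl])
          fix m assume "m \<in> ?N"
          then have m: "m < n" by simp
          have "(\<Oplus>l\<in>?N. x (i, m) \<otimes> (y (m, l) \<otimes> z (l, j)))
              = x (i, m) \<otimes> (\<Oplus>l\<in>?N. y (m, l) \<otimes> z (l, j))"
            using ij m x y z cl by (intro finsum_rdistr[symmetric]) auto
          then show "(\<Oplus>l\<in>?N. x (i, m) \<otimes> (y (m, l) \<otimes> z (l, j))) = x (i, m) \<otimes> (y \<otimes>\<^bsub>?M\<^esub> z) (m, j)"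
            using ij m by (simp add: mult)
        qed (use ij x cl mC[OF y z] in auto)
        also have "\<dots> = (x \<otimes>\<^bsub>?M\<^esub> (y \<otimes>\<^bsub>?M\<^esub> z)) (i, j)" using ij by (rule mult[symmetric])
        finally show "(x \<otimes>\<^bsub>?M\<^esub> y \<otimes>\<^bsub>?M\<^esub> z) (i, j) = (x \<otimes>\<^bsub>?M\<^esub> (y \<otimes>\<^bsub>?M\<^esub> z)) (i, j)" .
      qed (simp_all add: mC x y z)
    next
      fix x assume x: "x \<in> carrier ?M"
      show "\<one>\<^bsub>?M\<^esub> \<otimes>\<^bsub>?M\<^esub> x = x"
      proof (rule eqI)
        fix i j assume ij: "i < n" "j < n"
        show "(\<one>\<^bsub>?M\<^esub> \<otimes>\<^bsub>?M\<^esub> x) (i, j) = x (i, j)"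
          unfolding mult[OF ij]
          by (rule finsum_delta[where i = i]) (use ij x in \<open>simp_all add: one cl\<close>)
      qed (simp_all add: mC oC x)
      show "x \<otimes>\<^bsub>?M\<^esub> \<one>\<^bsub>?M\<^esub> = x"
      proof (rule eqI)
        fix i j assume ij: "i < n" "j < n"
        show "(x \<otimes>\<^bsub>?M\<^esub> \<one>\<^bsub>?M\<^esub>) (i, j) = x (i, j)"
          unfolding mult[OF ij]
          by (rule finsum_delta[where i = j]) (use ij x in \<open>simp_all add: one cl\<close>)
      qed (simp_all add: mC oC x)
    qed (simp_all add: mC oC)
  next
    fix x y z assume x: "x \<in> carrier ?M" and y: "y \<in> carrier ?M" and z: "z \<in> carrier ?M"
    show "(x \<oplus>\<^bsub>?M\<^esub> y) \<otimes>\<^bsub>?M\<^esub> z = x \<otimes>\<^bsub>?M\<^esub> z \<oplus>\<^bsub>?M\<^esub> y \<otimes>\<^bsub>?M\<^esub> z"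
    proof (rule eqI)
      fix i j assume ij: "i < n" "j < n"
      have "(\<Oplus>l\<in>?N. (x \<oplus>\<^bsub>?M\<^esub> y) (i, l) \<otimes> z (l, j))
          = (\<Oplus>l\<in>?N. x (i, l) \<otimes> z (l, j) \<oplus> y (i, l) \<otimes> z (l, j))"
        using ij x y z cl by (intro finsum_cong') (auto simp: add l_distr)
      also have "\<dots> = (\<Oplus>l\<in>?N. x (i, l) \<otimes> z (l, j)) \<oplus> (\<Oplus>l\<in>?N. y (i, l) \<otimes> z (l, j))"
        using ij x y z cl by (intro finsum_addf) auto
      finally show "((x \<oplus>\<^bsub>?M\<^esub> y) \<otimes>\<^bsub>?M\<^esub> z) (i, j) = (x \<otimes>\<^bsub>?M\<^esub> z \<oplus>\<^bsub>?M\<^esub> y \<otimes>\<^bsub>?M\<^esub> z) (i, j)"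
        using ij by (simp only: add mult)
    qed (simp_all add: mC addC x y z)
    show "z \<otimes>\<^bsub>?M\<^esub> (x \<oplus>\<^bsub>?M\<^esub> y) = z \<otimes>\<^bsub>?M\<^esub> x \<oplus>\<^bsub>?M\<^esub> z \<otimes>\<^bsub>?M\<^esub> y"
    proof (rule eqI)
      fix i j assume ij: "i < n" "j < n"
      have "(\<Oplus>l\<in>?N. z (i, l) \<otimes> (x \<oplus>\<^bsub>?M\<^esub> y) (l, j))
          = (\<Oplus>l\<in>?N. z (i, l) \<otimes> x (l, j) \<oplus> z (i, l) \<otimes> y (l, j))"
        using ij x y z cl by (intro finsum_cong') (auto simp: add r_distr)
      also have "\<dots> = (\<Oplus>l\<in>?N. z (i, l) \<otimes> x (l, j)) \<oplus> (\<Oplus>l\<in>?N. z (i, l) \<otimes> y (l, j))"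
        using ij x y z cl by (intro finsum_addf) auto
      finally show "(z \<otimes>\<^bsub>?M\<^esub> (x \<oplus>\<^bsub>?M\<^esub> y)) (i, j) = (z \<otimes>\<^bsub>?M\<^esub> x \<oplus>\<^bsub>?M\<^esub> z \<otimes>\<^bsub>?M\<^esub> y) (i, j)"
        using ij by (simp only: add mult)
    qed (simp_all add: mC addC x y z)
  qed
qed

lemma ring_group_ring:
  fixes k (structure) and G :: "('g,'m) monoid_scheme"
  assumes "ring k" "group G"
  shows "ring (group_ring k G)"
proof -
  interpret ring k by fact
  interpret G: group G by fact
  let ?R = "group_ring k G"
  let ?S = "gsupp k G"
  let ?C = "carrier G"
  have cl: "u g \<in> carrier k" if "u \<in> carrier ?R" "g \<in> ?C" for u g
    using that by (auto simp: group_ring_def)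
  have fin: "finite (?S u)" if "u \<in> carrier ?R" for u using that by (auto simp: group_ring_def)
  have sG: "h \<in> ?C" if "h \<in> ?S u" for h u using that by (simp add: gsupp_def)
  have ext: "u \<in> extensional ?C" if "u \<in> carrier ?R" for u using that by (auto simp: group_ring_def PiE_def)
  have CI: "u \<in> carrier ?R" if "u \<in> extensional ?C" "\<And>g. g \<in> ?C \<Longrightarrow> u g \<in> carrier k" 
     "finite F" "\<And>g. g \<in> ?C \<Longrightarrow> g \<notin> F \<Longrightarrow> u g = \<zero>" for u F
  proof -
    have "?S u \<subseteq> F" using that by (auto simp: gsupp_def)
    then have "finite (?S u)" using that finite_subset by blast
    then show ?thesis using that by (auto simp: group_ring_def PiE_def)
  qed
  have eqI: "a = b" if "a \<in> carrier ?R" "b \<in> carrier ?R" "\<And>g. g \<in> ?C \<Longrightarrow> a g = b g" for a b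
    using ext[OF that(1)] ext[OF that(2)] that(3) by (rule extensionalityI)
  have add: "(u \<oplus>\<^bsub>?R\<^esub> v) g = u g \<oplus> v g" if "g \<in> ?C" for u v g using that by (simp add: group_ring_def)
  have zero: "\<zero>\<^bsub>?R\<^esub> g = \<zero>" if "g \<in> ?C" for g using that by (simp add: group_ring_def)
  have one: "\<one>\<^bsub>?R\<^esub> g = (if g = \<one>\<^bsub>G\<^esub> then \<one> else \<zero>)" if "g \<in> ?C" for g using that by (simp add: group_ring_def)
  have mult: "(u \<otimes>\<^bsub>?R\<^esub> v) g = (\<Oplus>h\<in>F. u h \<otimes> v (inv\<^bsub>G\<^esub> h \<otimes>\<^bsub>G\<^esub> g))"
    if "g \<in> ?C" "finite F" "?S u \<subseteq> F" "F \<subseteq> ?C" "u \<in> carrier ?R" "v \<in> carrier ?R" for u v g F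
  proof -
    have "(u \<otimes>\<^bsub>?R\<^esub> v) g = (\<Oplus>h\<in>?S u. u h \<otimes> v (inv\<^bsub>G\<^esub> h \<otimes>\<^bsub>G\<^esub> g))" using that by (simp add: group_ring_def)
    also have "\<dots> = (\<Oplus>h\<in>F. u h \<otimes> v (inv\<^bsub>G\<^esub> h \<otimes>\<^bsub>G\<^esub> g))"
    proof (rule add.finprod_mono_neutral_cong_left)
      show "\<And>i. i \<in> F - ?S u \<Longrightarrow> u i \<otimes> v (inv\<^bsub>G\<^esub> i \<otimes>\<^bsub>G\<^esub> g) = \<zero>"
        using that cl by (auto simp: gsupp_def subset_iff)
    qed (use that cl in \<open>auto simp: subset_iff\<close>)
    finally show ?thesis .
  qed
  have addC: "u \<oplus>\<^bsub>?R\<^esub> v \<in> carrier ?R" if "u \<in> carrier ?R" "v \<in> carrier ?R" for u v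
    by (rule CI[of _ "?S u \<union> ?S v"])
       (use that in \<open>auto simp: add cl fin, auto simp: group_ring_def gsupp_def\<close>)
  have zC: "\<zero>\<^bsub>?R\<^esub> \<in> carrier ?R"
    by (rule CI[of _ "{}"]) (auto simp: zero, auto simp: group_ring_def)
  have oC: "\<one>\<^bsub>?R\<^esub> \<in> carrier ?R"
    by (rule CI[of _ "{\<one>\<^bsub>G\<^esub>}"]) (auto simp: one, auto simp: group_ring_def)
  have mC: "u \<otimes>\<^bsub>?R\<^esub> v \<in> carrier ?R" if u: "u \<in> carrier ?R" and v: "v \<in> carrier ?R" for u v
  proof (rule CI[of _ "(\<lambda>(a,b). a \<otimes>\<^bsub>G\<^esub> b) ` (?S u \<times> ?S v)"])
    show "u \<otimes>\<^bsub>?R\<^esub> v \<in> extensional ?C" by (auto simp: group_ring_def)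
    show "(u \<otimes>\<^bsub>?R\<^esub> v) g \<in> carrier k" if "g \<in> ?C" for g
      using that u v by (subst mult[of _ "?S u"]) (auto simp: fin cl sG intro!: finsum_closed)
    show "finite ((\<lambda>(a,b). a \<otimes>\<^bsub>G\<^esub> b) ` (?S u \<times> ?S v))" using u v fin by auto
    fix g assume g: "g \<in> ?C" "g \<notin> (\<lambda>(a,b). a \<otimes>\<^bsub>G\<^esub> b) ` (?S u \<times> ?S v)"
    have "v (inv\<^bsub>G\<^esub> h \<otimes>\<^bsub>G\<^esub> g) = \<zero>" if h: "h \<in> ?S u" for h
    proof (rule ccontr)
      assume "v (inv\<^bsub>G\<^esub> h \<otimes>\<^bsub>G\<^esub> g) \<noteq> \<zero>"
      then have "inv\<^bsub>G\<^esub> h \<otimes>\<^bsub>G\<^esub> g \<in> ?S v" using sG[OF h] g by (simp add: gsupp_def)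
      moreover have "g = h \<otimes>\<^bsub>G\<^esub> (inv\<^bsub>G\<^esub> h \<otimes>\<^bsub>G\<^esub> g)" using sG[OF h] g by (simp add: G.m_assoc[symmetric])
      ultimately show False using g h by (metis (no_types, lifting) SigmaI case_prod_conv image_eqI)
    qed
    then show "(u \<otimes>\<^bsub>?R\<^esub> v) g = \<zero>"
      using g u v by (subst mult[of _ "?S u"]) (auto simp: fin cl sG intro!: add.finprod_one_eqI)
  qed
  note C = addC zC oC mC
  show ?thesis
  proof (rule ringI)
    show "abelian_group ?R"
    proof (rule abelian_groupI)
      fix x assume x: "x \<in> carrier ?R"
      let ?y = "\<lambda>g\<in>?C. \<ominus> x g"
      have y: "?y \<in> carrier ?R" by (rule CI[of _ "?S x"]) (use x fin[OF x] in \<open>auto simp: cl gsupp_def\<close>)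
      show "\<exists>y\<in>carrier ?R. y \<oplus>\<^bsub>?R\<^esub> x = \<zero>\<^bsub>?R\<^esub>"
        by (rule bexI[of _ ?y]) (use x y in \<open>auto simp: add zero cl l_neg C intro!: eqI\<close>)
    qed (auto simp: add zero cl C a_ac intro!: eqI)
    show "monoid ?R"
    proof (rule monoidI)
      fix x y z assume x: "x \<in> carrier ?R" and y: "y \<in> carrier ?R" and z: "z \<in> carrier ?R"
      show "x \<otimes>\<^bsub>?R\<^esub> y \<otimes>\<^bsub>?R\<^esub> z = x \<otimes>\<^bsub>?R\<^esub> (y \<otimes>\<^bsub>?R\<^esub> z)"
      proof (rule eqI)
        fix g assume g: "g \<in> ?C"
        define U where "U = (\<lambda>(a,b). a \<otimes>\<^bsub>G\<^esub> b) ` (?S x \<times> ?S y) \<union> ?S (x \<otimes>\<^bsub>?R\<^esub> y)"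
        have U: "finite U" "U \<subseteq> ?C" "?S (x \<otimes>\<^bsub>?R\<^esub> y) \<subseteq> U" using x y C fin sG by (auto simp: U_def)
        let ?i = "\<lambda>h. inv\<^bsub>G\<^esub> h"
        have "(x \<otimes>\<^bsub>?R\<^esub> y \<otimes>\<^bsub>?R\<^esub> z) g = (\<Oplus>w\<in>U. (x \<otimes>\<^bsub>?R\<^esub> y) w \<otimes> z (?i w \<otimes>\<^bsub>G\<^esub> g))"
          using g U x y z C by (intro mult) auto
        also have "\<dots> = (\<Oplus>w\<in>U. \<Oplus>a\<in>?S x. x a \<otimes> (y (?i a \<otimes>\<^bsub>G\<^esub> w) \<otimes> z (?i w \<otimes>\<^bsub>G\<^esub> g)))"
        proof (rule finsum_cong'[OF refl])
          fix w assume w: "w \<in> U"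
          then have wc: "w \<in> ?C" using U by auto
          have "(x \<otimes>\<^bsub>?R\<^esub> y) w = (\<Oplus>a\<in>?S x. x a \<otimes> y (?i a \<otimes>\<^bsub>G\<^esub> w))"
            using wc x y fin sG by (intro mult) auto
          also have "\<dots> \<otimes> z (?i w \<otimes>\<^bsub>G\<^esub> g) = (\<Oplus>a\<in>?S x. (x a \<otimes> y (?i a \<otimes>\<^bsub>G\<^esub> w)) \<otimes> z (?i w \<otimes>\<^bsub>G\<^esub> g))"
            using wc x y z fin sG cl g by (intro finsum_ldistr) auto
          also have "\<dots> = (\<Oplus>a\<in>?S x. x a \<otimes> (y (?i a \<otimes>\<^bsub>G\<^esub> w) \<otimes> z (?i w \<otimes>\<^bsub>G\<^esub> g)))"
            using wc x y z sG cl g by (intro finsum_cong') (auto simp: m_assoc)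
          finally show "(x \<otimes>\<^bsub>?R\<^esub> y) w \<otimes> z (?i w \<otimes>\<^bsub>G\<^esub> g) = (\<Oplus>a\<in>?S x. x a \<otimes> (y (?i a \<otimes>\<^bsub>G\<^esub> w) \<otimes> z (?i w \<otimes>\<^bsub>G\<^esub> g)))" .
        qed (use U x y z sG cl g in \<open>auto simp: subset_iff intro!: finsum_closed\<close>)
        also have "\<dots> = (\<Oplus>a\<in>?S x. \<Oplus>w\<in>U. x a \<otimes> (y (?i a \<otimes>\<^bsub>G\<^esub> w) \<otimes> z (?i w \<otimes>\<^bsub>G\<^esub> g)))"
          using U x y z sG cl g fin by (intro finsum_swap) (auto simp: subset_iff)
        also have "\<dots> = (\<Oplus>a\<in>?S x. x a \<otimes> (y \<otimes>\<^bsub>?R\<^esub> z) (?i a \<otimes>\<^bsub>G\<^esub> g))"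
        proof (rule finsum_cong'[OF refl])
          fix a assume a: "a \<in> ?S x"
          then have ac: "a \<in> ?C" using sG by auto
          let ?t = "\<lambda>w. y (?i a \<otimes>\<^bsub>G\<^esub> w) \<otimes> z (?i w \<otimes>\<^bsub>G\<^esub> g)"
          have im: "(\<lambda>b. a \<otimes>\<^bsub>G\<^esub> b) ` ?S y \<subseteq> U" using a by (auto simp: U_def)
          have "(\<Oplus>w\<in>U. x a \<otimes> ?t w) = x a \<otimes> (\<Oplus>w\<in>U. ?t w)"
            using U x y z ac cl g by (intro finsum_rdistr[symmetric]) (auto simp: subset_iff)
          also have "(\<Oplus>w\<in>U. ?t w) = (\<Oplus>w\<in>(\<lambda>b. a \<otimes>\<^bsub>G\<^esub> b) ` ?S y. ?t w)"
          proof (rule add.finprod_mono_neutral_cong_right)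
            fix w assume w: "w \<in> U - (\<lambda>b. a \<otimes>\<^bsub>G\<^esub> b) ` ?S y"
            then have wc: "w \<in> ?C" using U by auto
            have "w = a \<otimes>\<^bsub>G\<^esub> (?i a \<otimes>\<^bsub>G\<^esub> w)" using ac wc by (simp add: G.m_assoc[symmetric])
            then have "?i a \<otimes>\<^bsub>G\<^esub> w \<notin> ?S y" using w by blast
            then have "y (?i a \<otimes>\<^bsub>G\<^esub> w) = \<zero>" using ac wc by (simp add: gsupp_def)
            then show "?t w = \<zero>" using wc z g cl by simp
          qed (use U im x y z ac cl g in \<open>auto simp: subset_iff\<close>)
          also have "\<dots> = (\<Oplus>b\<in>?S y. ?t (a \<otimes>\<^bsub>G\<^esub> b))"
            using ac x y z cl g sG by (intro finsum_reindex) (auto simp: inj_on_def)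
          also have "\<dots> = (\<Oplus>b\<in>?S y. y b \<otimes> z (?i b \<otimes>\<^bsub>G\<^esub> (?i a \<otimes>\<^bsub>G\<^esub> g)))"
            using ac y z cl g sG by (intro finsum_cong') (auto simp: G.m_assoc[symmetric] G.inv_mult_group)
          also have "\<dots> = (y \<otimes>\<^bsub>?R\<^esub> z) (?i a \<otimes>\<^bsub>G\<^esub> g)"
            using ac y z g sG fin by (intro mult[symmetric]) auto
          finally show "(\<Oplus>w\<in>U. x a \<otimes> ?t w) = x a \<otimes> (y \<otimes>\<^bsub>?R\<^esub> z) (?i a \<otimes>\<^bsub>G\<^esub> g)" .
        qed (use x y z sG cl g C in auto)
        also have "\<dots> = (x \<otimes>\<^bsub>?R\<^esub> (y \<otimes>\<^bsub>?R\<^esub> z)) g"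
          using x y z g sG fin C by (intro mult[symmetric]) auto
        finally show "(x \<otimes>\<^bsub>?R\<^esub> y \<otimes>\<^bsub>?R\<^esub> z) g = (x \<otimes>\<^bsub>?R\<^esub> (y \<otimes>\<^bsub>?R\<^esub> z)) g" .
      qed (use x y z C in auto)
    next
      fix x assume x: "x \<in> carrier ?R"
      show "\<one>\<^bsub>?R\<^esub> \<otimes>\<^bsub>?R\<^esub> x = x"
      proof (rule eqI)
        fix g assume g: "g \<in> ?C"
        have "(\<one>\<^bsub>?R\<^esub> \<otimes>\<^bsub>?R\<^esub> x) g = (\<Oplus>h\<in>{\<one>\<^bsub>G\<^esub>}. \<one>\<^bsub>?R\<^esub> h \<otimes> x (inv\<^bsub>G\<^esub> h \<otimes>\<^bsub>G\<^esub> g))"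
          using x C g by (intro mult) (auto simp: gsupp_def one split: if_splits)
        also have "\<dots> = x g" using x cl g by (intro finsum_delta[where i="\<one>\<^bsub>G\<^esub>"]) (auto simp: one)
        finally show "(\<one>\<^bsub>?R\<^esub> \<otimes>\<^bsub>?R\<^esub> x) g = x g" .
      qed (use x C in auto)
      show "x \<otimes>\<^bsub>?R\<^esub> \<one>\<^bsub>?R\<^esub> = x"
      proof (rule eqI)
        fix g assume g: "g \<in> ?C"
        have "(x \<otimes>\<^bsub>?R\<^esub> \<one>\<^bsub>?R\<^esub>) g = (\<Oplus>h\<in>insert g (?S x). x h \<otimes> \<one>\<^bsub>?R\<^esub> (inv\<^bsub>G\<^esub> h \<otimes>\<^bsub>G\<^esub> g))"
          using x C g fin sG by (intro mult) auto
        also have "\<dots> = x g"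
        proof (rule finsum_delta[where i=g])
          fix h assume "h \<in> insert g (?S x)"
          then have h: "h \<in> ?C" using g sG by auto
          have "inv\<^bsub>G\<^esub> h \<otimes>\<^bsub>G\<^esub> g = \<one>\<^bsub>G\<^esub> \<longleftrightarrow> h = g"
            using h g by (metis G.inv_closed G.inv_equality G.inv_inv G.l_inv)
          then show "x h \<otimes> \<one>\<^bsub>?R\<^esub> (inv\<^bsub>G\<^esub> h \<otimes>\<^bsub>G\<^esub> g) = (if h = g then x g else \<zero>)"
            using h g x cl by (auto simp: one)
        qed (use x fin cl g in auto)
        finally show "(x \<otimes>\<^bsub>?R\<^esub> \<one>\<^bsub>?R\<^esub>) g = x g" .
      qed (use x C in auto)
    qed (use C in auto)
  next
    fix x y z assume x: "x \<in> carrier ?R" and y: "y \<in> carrier ?R" and z: "z \<in> carrier ?R"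
    let ?F = "?S x \<union> ?S y"
    have F: "finite ?F" "?F \<subseteq> ?C" using x y fin sG by auto
    show "(x \<oplus>\<^bsub>?R\<^esub> y) \<otimes>\<^bsub>?R\<^esub> z = x \<otimes>\<^bsub>?R\<^esub> z \<oplus>\<^bsub>?R\<^esub> y \<otimes>\<^bsub>?R\<^esub> z"
    proof (rule eqI)
      fix g assume g: "g \<in> ?C"
      let ?t = "\<lambda>u h. u h \<otimes> z (inv\<^bsub>G\<^esub> h \<otimes>\<^bsub>G\<^esub> g)"
      have s: "?S (x \<oplus>\<^bsub>?R\<^esub> y) \<subseteq> ?F" by (auto simp: gsupp_def add)
      have "((x \<oplus>\<^bsub>?R\<^esub> y) \<otimes>\<^bsub>?R\<^esub> z) g = (\<Oplus>h\<in>?F. ?t (x \<oplus>\<^bsub>?R\<^esub> y) h)"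
        using g F s addC[OF x y] z by (intro mult)
      also have "\<dots> = (\<Oplus>h\<in>?F. ?t x h \<oplus> ?t y h)"
        using x y z cl g sG by (intro finsum_cong') (auto simp: add l_distr)
      also have "\<dots> = (\<Oplus>h\<in>?F. ?t x h) \<oplus> (\<Oplus>h\<in>?F. ?t y h)"
        using x y z cl g sG by (intro finsum_addf) auto
      also have "(\<Oplus>h\<in>?F. ?t x h) = (x \<otimes>\<^bsub>?R\<^esub> z) g"
        using g F x z by (intro mult[symmetric]) auto
      also have "(\<Oplus>h\<in>?F. ?t y h) = (y \<otimes>\<^bsub>?R\<^esub> z) g"
        using g F y z by (intro mult[symmetric]) auto
      finally show "((x \<oplus>\<^bsub>?R\<^esub> y) \<otimes>\<^bsub>?R\<^esub> z) g = (x \<otimes>\<^bsub>?R\<^esub> z \<oplus>\<^bsub>?R\<^esub> y \<otimes>\<^bsub>?R\<^esub> z) g"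
        using g by (simp add: add)
    qed (use x y z C in auto)
    show "z \<otimes>\<^bsub>?R\<^esub> (x \<oplus>\<^bsub>?R\<^esub> y) = z \<otimes>\<^bsub>?R\<^esub> x \<oplus>\<^bsub>?R\<^esub> z \<otimes>\<^bsub>?R\<^esub> y"
    proof (rule eqI)
      fix g assume g: "g \<in> ?C"
      let ?t = "\<lambda>u h. z h \<otimes> u (inv\<^bsub>G\<^esub> h \<otimes>\<^bsub>G\<^esub> g)"
      have S: "finite (?S z)" "?S z \<subseteq> ?C" using z fin sG by auto
      have "(z \<otimes>\<^bsub>?R\<^esub> (x \<oplus>\<^bsub>?R\<^esub> y)) g = (\<Oplus>h\<in>?S z. ?t (x \<oplus>\<^bsub>?R\<^esub> y) h)"
        using g S addC[OF x y] z by (intro mult) auto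
      also have "\<dots> = (\<Oplus>h\<in>?S z. ?t x h \<oplus> ?t y h)"
        using x y z cl g sG by (intro finsum_cong') (auto simp: add r_distr)
      also have "\<dots> = (\<Oplus>h\<in>?S z. ?t x h) \<oplus> (\<Oplus>h\<in>?S z. ?t y h)"
        using x y z cl g sG by (intro finsum_addf) auto
      also have "(\<Oplus>h\<in>?S z. ?t x h) = (z \<otimes>\<^bsub>?R\<^esub> x) g"
        using g S x z by (intro mult[symmetric]) auto
      also have "(\<Oplus>h\<in>?S z. ?t y h) = (z \<otimes>\<^bsub>?R\<^esub> y) g"
        using g S y z by (intro mult[symmetric]) auto
      finally show "(z \<otimes>\<^bsub>?R\<^esub> (x \<oplus>\<^bsub>?R\<^esub> y)) g = (z \<otimes>\<^bsub>?R\<^esub> x \<oplus>\<^bsub>?R\<^esub> z \<otimes>\<^bsub>?R\<^esub> y) g"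
        using g by (simp add: add)
    qed (use x y z C in auto)
  qed
qed

end

theory Submission
  imports Defs "HOL-Number_Theory.Residues"
begin

text \<open>
  The proof is a linear version of surjunctivity over finite rings, followed by a reduction of an
  arbitrary field to finite rings.

  Let \<open>F\<close> be a finite ring.  A matrix \<open>a\<close> over \<open>F[G]\<close> acts on the configurations with values in the
  finite alphabet \<open>F\<^sup>n\<close> by \<open>(a \<cdot> c)(g) = (\<Sum>h. a(h) c(gh))\<close>.  Only the finitely many \<open>h\<close> in the
  support of \<open>a\<close> matter, so this is a cellular automaton, and composition of these automata
  corresponds to multiplication of matrices.  If \<open>a b = 1\<close>, then \<open>b\<close> acts injectively; surjunctivity
  makes the action of \<open>b\<close> bijective, so \<open>a\<close> acts as its two-sided inverse and \<open>b a\<close> acts trivially.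
  The action is faithful, hence \<open>b a = 1\<close>.  This is \<open>directly_finite_of_surjunctive\<close>.

  Let now \<open>k\<close> be a field, \<open>a b = 1\<close> over \<open>k[G]\<close>, and suppose that \<open>b a - 1\<close> has a nonzero
  coefficient \<open>d\<close>.  The finitely many coefficients of \<open>a\<close> and \<open>b\<close> lie in a finitely generated
  subring \<open>C\<close> of \<open>k\<close>, and then so does \<open>d\<close>.  Some homomorphism from \<open>C\<close> to a finite commutative ring
  \<open>F \<noteq> 0\<close> maps \<open>d\<close> to a unit (\<open>finite_subset_in_specializable_subring\<close>).  Applying it to all
  coefficients gives matrices over \<open>F[G]\<close> which contradict the finite case.

  The existence of such homomorphisms is the arithmetic form of the Nullstellensatz.  It is proved
  by adjoining one generator \<open>x\<close> at a time to a domain \<open>S\<close> which already has the property, starting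
  with the image of the integers.  A homomorphism \<open>S \<rightarrow> F\<close> is extended to
  \<open>S[X] \<rightarrow> F[X] / (q)\<close>, where the leading coefficient of \<open>q\<close> becomes a unit of \<open>F\<close>, so that the
  quotient is again finite and nonzero.  If \<open>x\<close> is transcendental over \<open>S\<close> and \<open>d = f(x)\<close>, the choice
  \<open>q = X f + 1\<close> turns \<open>f\<close> into a unit.  If \<open>x\<close> is algebraic, \<open>q\<close> is a polynomial of least degree that
  vanishes at \<open>x\<close>, and \<open>d\<close> divides a nonzero element of \<open>S\<close> (\<open>constant_multiple_of_algebraic_value\<close>),
  which can be made a unit as well.  Since the targets are finite rings instead of finite fields, the
  image of \<open>q\<close> in \<open>F[X]\<close> may be reducible.
\<close>

section \<open>Specialization to finite commutative rings\<close>

text \<open>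
  The condition asks for a unit rather than for a nonzero value because only this strong form can
  be passed on when a generator is adjoined: leading coefficients must become invertible.
  The finite rings have elements in \<^typ>\<open>nat\<close>, so that the property does not mention a type that
  grows with every adjunction.
\<close>

definition finitely_specializable :: "('a, 'm) ring_scheme \<Rightarrow> bool" where
  "finitely_specializable S \<longleftrightarrow>
     (\<forall>d\<in>carrier S - {\<zero>\<^bsub>S\<^esub>}. \<exists>(F :: nat ring) \<phi>.
        cring F \<and> finite (carrier F) \<and> \<one>\<^bsub>F\<^esub> \<noteq> \<zero>\<^bsub>F\<^esub> \<and> \<phi> \<in> ring_hom S F \<and> \<phi> d \<in> Units F)"

lemma ring_hom_Units:
  assumes "h \<in> ring_hom R S" "x \<in> Units R"
  shows "h x \<in> Units S"
proof -
  obtain y where y: "y \<in> carrier R" "x \<in> carrier R" "y \<otimes>\<^bsub>R\<^esub> x = \<one>\<^bsub>R\<^esub>" "x \<otimes>\<^bsub>R\<^esub> y = \<one>\<^bsub>R\<^esub>"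
    using assms(2) unfolding Units_def by blast
  then have "h y \<otimes>\<^bsub>S\<^esub> h x = \<one>\<^bsub>S\<^esub>" "h x \<otimes>\<^bsub>S\<^esub> h y = \<one>\<^bsub>S\<^esub>"
    using ring_hom_memE(2,4)[OF assms(1)] by metis+
  moreover have "h x \<in> carrier S" "h y \<in> carrier S"
    using y ring_hom_memE(1)[OF assms(1)] by auto
  ultimately show ?thesis unfolding Units_def by blast
qed

lemma finite_ring_on_nat:
  fixes F :: "('b, 'm) ring_scheme"
  assumes "cring F" "finite (carrier F)" "\<one>\<^bsub>F\<^esub> \<noteq> \<zero>\<^bsub>F\<^esub>"
  obtains F' :: "nat ring" and f where
    "cring F'" "finite (carrier F')" "\<one>\<^bsub>F'\<^esub> \<noteq> \<zero>\<^bsub>F'\<^esub>" "f \<in> ring_hom F F'"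
proof -
  interpret cring F by fact
  obtain f :: "'b \<Rightarrow> nat" where f: "inj_on f (carrier F)"
    using finite_imp_inj_to_nat_seg[OF assms(2)] by blast
  let ?F = "image_ring f F"
  have iso: "f \<in> ring_iso F ?F" by (rule inj_imp_image_ring_iso[OF f])
  have "?F\<lparr>zero := f \<zero>\<^bsub>F\<^esub>\<rparr> = ?F"
    by (simp add: image_ring_def image_group_def monoid.defs)
  then have "cring ?F" using ring_iso_imp_img_cring[OF iso] by simp
  moreover have "finite (carrier ?F)" using assms(2) by (simp add: image_ring_carrier)
  moreover have "\<one>\<^bsub>?F\<^esub> \<noteq> \<zero>\<^bsub>?F\<^esub>"
    using f assms(3) by (auto simp: image_ring_one image_ring_zero dest: inj_onD)
  moreover have "f \<in> ring_hom F ?F" using iso by (simp add: ring_iso_def)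
  ultimately show thesis by (rule that)
qed

text \<open>
  The witnesses may live in any type, since a finite ring can be copied to \<^typ>\<open>nat\<close>.
\<close>

lemma finitely_specializableI:
  assumes "\<And>d. d \<in> carrier S \<Longrightarrow> d \<noteq> \<zero>\<^bsub>S\<^esub> \<Longrightarrow>
    \<exists>(F :: ('b, 'q) ring_scheme) \<phi>. cring F \<and> finite (carrier F) \<and> \<one>\<^bsub>F\<^esub> \<noteq> \<zero>\<^bsub>F\<^esub> \<and>
      \<phi> \<in> ring_hom S F \<and> \<phi> d \<in> Units F"
  shows "finitely_specializable S"
  unfolding finitely_specializable_def
proof
  fix d assume "d \<in> carrier S - {\<zero>\<^bsub>S\<^esub>}"
  then obtain F :: "('b, 'q) ring_scheme" and \<phi> where F: "cring F" "finite (carrier F)" "\<one>\<^bsub>F\<^esub> \<noteq> \<zero>\<^bsub>F\<^esub>"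
    and \<phi>: "\<phi> \<in> ring_hom S F" "\<phi> d \<in> Units F" using assms by blast
  from F obtain F' :: "nat ring" and f where F': "cring F'" "finite (carrier F')" "\<one>\<^bsub>F'\<^esub> \<noteq> \<zero>\<^bsub>F'\<^esub>"
    and f: "f \<in> ring_hom F F'" by (rule finite_ring_on_nat)
  show "\<exists>(F :: nat ring) \<phi>. cring F \<and> finite (carrier F) \<and> \<one>\<^bsub>F\<^esub> \<noteq> \<zero>\<^bsub>F\<^esub> \<and>
      \<phi> \<in> ring_hom S F \<and> \<phi> d \<in> Units F"
    using F' ring_hom_trans[OF \<phi>(1) f] ring_hom_Units[OF f \<phi>(2)] by (metis comp_apply)
qed

section \<open>Extending a specialization to polynomials\<close>

lemma (in UP_cring) coeff_mult_top:
  assumes p: "p \<in> carrier P" and q: "q \<in> carrier P"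
  shows "up_ring.coeff P (p \<otimes>\<^bsub>P\<^esub> q) (deg R p + deg R q) = lcoeff p \<otimes> lcoeff q"
proof -
  have "(\<Oplus>i\<in>{..deg R p + deg R q}. up_ring.coeff P p i \<otimes> up_ring.coeff P q (deg R p + deg R q - i))
      = lcoeff p \<otimes> lcoeff q"
  proof (rule R.finsum_delta[where i = "deg R p"])
    fix i
    consider "i = deg R p" | "deg R p < i" | "deg R q < deg R p + deg R q - i" by linarith
    then show "up_ring.coeff P p i \<otimes> up_ring.coeff P q (deg R p + deg R q - i)
        = (if i = deg R p then lcoeff p \<otimes> lcoeff q else \<zero>)"
      by cases (use p q deg_aboveD in auto)
  qed (use p q in auto)
  then show ?thesis using p q by simp
qed

text \<open>
  Division by \<open>q\<close> represents every class by one of the finitely many polynomials of smaller degree,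
  and no multiple of \<open>q\<close> is a nonzero constant since leading coefficients cannot cancel.
\<close>

lemma (in UP_cring) quotient_by_unit_lcoeff:
  assumes q: "q \<in> carrier P" and deg: "deg R q > 0" and unit: "lcoeff q \<in> Units R"
    and R: "finite (carrier R)" "\<one> \<noteq> \<zero>"
  shows "finite (carrier (P Quot PIdl\<^bsub>P\<^esub> q))"
    and "\<one>\<^bsub>P Quot PIdl\<^bsub>P\<^esub> q\<^esub> \<noteq> \<zero>\<^bsub>P Quot PIdl\<^bsub>P\<^esub> q\<^esub>"
proof -
  let ?I = "PIdl\<^bsub>P\<^esub> q"
  interpret I: ideal ?I P using q by (rule P.cgenideal_ideal)
  define B where "B = {r \<in> carrier P. deg R r < deg R q}"
  have "inj_on (\<lambda>r. restrict (up_ring.coeff P r) {..<deg R q}) B"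
  proof (rule inj_onI)
    fix r s assume r: "r \<in> B" and s: "s \<in> B"
      and eq: "restrict (up_ring.coeff P r) {..<deg R q} = restrict (up_ring.coeff P s) {..<deg R q}"
    show "r = s"
    proof (rule up_eqI)
      fix n
      show "up_ring.coeff P r n = up_ring.coeff P s n"
      proof (cases "n < deg R q")
        case True then show ?thesis using fun_cong[OF eq, of n] by simp
      next
        case False then show ?thesis using r s deg_aboveD[of r n] deg_aboveD[of s n] by (simp add: B_def)
      qed
    qed (use r s in \<open>auto simp: B_def\<close>)
  qed
  moreover have "(\<lambda>r. restrict (up_ring.coeff P r) {..<deg R q}) ` B \<subseteq> {..<deg R q} \<rightarrow>\<^sub>E carrier R"
    unfolding image_subset_iff restrict_PiE_iff by (auto simp: B_def)
  moreover have "finite ({..<deg R q} \<rightarrow>\<^sub>E carrier R)" using R(1) by (intro finite_PiE) auto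
  ultimately have "finite B" by (rule inj_on_finite)
  moreover have "carrier (P Quot ?I) \<subseteq> (\<lambda>r. ?I +>\<^bsub>P\<^esub> r) ` B"
  proof
    fix C assume "C \<in> carrier (P Quot ?I)"
    then obtain f where f: "f \<in> carrier P" "C = ?I +>\<^bsub>P\<^esub> f"
      unfolding FactRing_def A_RCOSETS_def' by auto
    have "q \<noteq> \<zero>\<^bsub>P\<^esub>" using deg by auto
    then obtain g r and m :: nat where g: "g \<in> carrier P" and r: "r \<in> carrier P"
      and div: "lcoeff q [^] m \<odot>\<^bsub>P\<^esub> f = q \<otimes>\<^bsub>P\<^esub> g \<oplus>\<^bsub>P\<^esub> r"
      and small: "r = \<zero>\<^bsub>P\<^esub> \<or> deg R r < deg R q"
      using long_div_theorem[OF q f(1)] by blast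
    have u: "lcoeff q [^] m \<in> Units R" using unit by (rule R.Units_pow_closed)
    define v where "v = inv (lcoeff q [^] m)"
    have v: "v \<in> carrier R" "v \<otimes> lcoeff q [^] m = \<one>" using u by (simp_all add: v_def)
    have "f = v \<odot>\<^bsub>P\<^esub> (lcoeff q [^] m \<odot>\<^bsub>P\<^esub> f)"
      using v u f q by (simp add: UP_smult_assoc1[symmetric] R.Units_closed)
    also have "\<dots> = (v \<odot>\<^bsub>P\<^esub> g) \<otimes>\<^bsub>P\<^esub> q \<oplus>\<^bsub>P\<^esub> v \<odot>\<^bsub>P\<^esub> r"
      using v g r q UP_smult_assoc2[of v g q] UP_m_comm[of q g] by (simp add: div UP_smult_r_distr)
    finally have f_eq: "f = (v \<odot>\<^bsub>P\<^esub> g) \<otimes>\<^bsub>P\<^esub> q \<oplus>\<^bsub>P\<^esub> v \<odot>\<^bsub>P\<^esub> r" .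
    have cl: "(v \<odot>\<^bsub>P\<^esub> g) \<otimes>\<^bsub>P\<^esub> q \<in> carrier P" "v \<odot>\<^bsub>P\<^esub> r \<in> carrier P" using v g q r by auto
    have "f \<ominus>\<^bsub>P\<^esub> v \<odot>\<^bsub>P\<^esub> r = (v \<odot>\<^bsub>P\<^esub> g) \<otimes>\<^bsub>P\<^esub> q"
      unfolding f_eq using cl by (simp add: P.minus_eq P.a_assoc P.r_neg)
    then have "f \<ominus>\<^bsub>P\<^esub> v \<odot>\<^bsub>P\<^esub> r \<in> ?I" unfolding cgenideal_def using v g by auto
    then have "C = ?I +>\<^bsub>P\<^esub> (v \<odot>\<^bsub>P\<^esub> r)"
      using P.quotient_eq_iff_same_a_r_cos[OF I.is_ideal] f cl by blast
    moreover have "v \<odot>\<^bsub>P\<^esub> r \<in> B"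
      using small deg deg_smult_decr[OF v(1) r] cl by (auto simp: B_def)
    ultimately show "C \<in> (\<lambda>r. ?I +>\<^bsub>P\<^esub> r) ` B" by blast
  qed
  ultimately show "finite (carrier (P Quot ?I))" by (meson finite_imageI finite_subset)
  show "\<one>\<^bsub>P Quot ?I\<^esub> \<noteq> \<zero>\<^bsub>P Quot ?I\<^esub>"
  proof
    assume "\<one>\<^bsub>P Quot ?I\<^esub> = \<zero>\<^bsub>P Quot ?I\<^esub>"
    then have "\<one>\<^bsub>P\<^esub> \<in> ?I" unfolding FactRing_def using I.a_rcos_self[of "\<one>\<^bsub>P\<^esub>"] by simp
    then obtain x where x: "x \<in> carrier P" "\<one>\<^bsub>P\<^esub> = x \<otimes>\<^bsub>P\<^esub> q" unfolding cgenideal_def by blast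
    have "lcoeff x \<otimes> lcoeff q = \<zero>"
      using coeff_mult_top[OF x(1) q] deg unfolding x(2)[symmetric] by simp
    then have "lcoeff x = \<zero>" using unit x(1)
      by (metis R.Units_closed R.Units_l_cancel R.m_comm R.r_null lcoeff_closed R.zero_closed)
    then have "x = \<zero>\<^bsub>P\<^esub>" using lcoeff_nonzero x(1) by blast
    then have "\<one>\<^bsub>P\<^esub> = \<zero>\<^bsub>P\<^esub>" using x q by simp
    then have "up_ring.coeff P \<one>\<^bsub>P\<^esub> 0 = up_ring.coeff P \<zero>\<^bsub>P\<^esub> 0" by simp
    then show False using R(2) by simp
  qed
qed

lemma UP_map_hom:
  assumes R: "cring R" and F: "cring F" and \<phi>: "\<phi> \<in> ring_hom R F"
  shows "(\<lambda>p n. \<phi> (p n)) \<in> ring_hom (UP R) (UP F)"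
    and "p \<in> carrier (UP R) \<Longrightarrow> up_ring.coeff (UP F) (\<lambda>n. \<phi> (p n)) n = \<phi> (up_ring.coeff (UP R) p n)"
proof -
  let ?m = "\<lambda>p n. \<phi> (p n)"
  have carrier: "carrier (UP R) = up R" "carrier (UP F) = up F" by (simp_all add: UP_def)
  have cf: "up_ring.coeff (UP R) p n = p n" if "p \<in> carrier (UP R)" for p n
    using that by (simp add: UP_def)
  have cf': "up_ring.coeff (UP F) p n = p n" if "p \<in> carrier (UP F)" for p n
    using that by (simp add: UP_def)
  interpret hom: ring_hom_cring R F \<phi>
    by (rule ring_hom_cring.intro[OF R F], rule ring_hom_cring_axioms.intro[OF \<phi>])
  have cl: "?m p \<in> carrier (UP F)" if p: "p \<in> carrier (UP R)" for p
  proof -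
    have p': "p \<in> up R" using p carrier by blast
    then obtain n where "bound \<zero>\<^bsub>R\<^esub> n p" unfolding up_def by blast
    then have "bound \<zero>\<^bsub>F\<^esub> n (?m p)" unfolding bound_def by simp
    then have "?m p \<in> up F" using p' by (intro mem_upI) auto
    then show ?thesis using carrier by blast
  qed
  interpret A: UP_cring R "UP R" by (rule UP_cring.intro, rule R, rule reflexive)
  interpret B: UP_cring F "UP F" by (rule UP_cring.intro, rule F, rule reflexive)
  have co: "up_ring.coeff (UP F) (?m p) n = \<phi> (up_ring.coeff (UP R) p n)" if "p \<in> carrier (UP R)" for p n
    using that cl by (simp add: cf cf')
  show "p \<in> carrier (UP R) \<Longrightarrow> up_ring.coeff (UP F) (\<lambda>n. \<phi> (p n)) n = \<phi> (up_ring.coeff (UP R) p n)" by (rule co)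
  show "?m \<in> ring_hom (UP R) (UP F)"
  proof (rule ring_hom_memI)
    fix p q assume p: "p \<in> carrier (UP R)" and q: "q \<in> carrier (UP R)"
    show "?m (p \<oplus>\<^bsub>UP R\<^esub> q) = ?m p \<oplus>\<^bsub>UP F\<^esub> ?m q"
      by (rule B.up_eqI) (use p q cl in \<open>simp_all add: co\<close>)
    show "?m (p \<otimes>\<^bsub>UP R\<^esub> q) = ?m p \<otimes>\<^bsub>UP F\<^esub> ?m q"
      by (rule B.up_eqI) (use p q cl in \<open>simp_all add: co o_def Pi_def\<close>)
  next
    show "?m \<one>\<^bsub>UP R\<^esub> = \<one>\<^bsub>UP F\<^esub>"
      by (rule B.up_eqI) (use cl in \<open>simp_all add: co\<close>)
  qed (rule cl)
qed

lemma hom_factors_through_image: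
  assumes "ring P" "ring K" "ring F" and h: "h \<in> ring_hom P K" and \<psi>: "\<psi> \<in> ring_hom P F"
    and ker: "\<And>f. f \<in> carrier P \<Longrightarrow> h f = \<zero>\<^bsub>K\<^esub> \<Longrightarrow> \<psi> f = \<zero>\<^bsub>F\<^esub>"
  obtains \<theta> where "\<theta> \<in> ring_hom (K\<lparr>carrier := h ` carrier P\<rparr>) F"
    and "\<And>f. f \<in> carrier P \<Longrightarrow> \<theta> (h f) = \<psi> f"
proof
  interpret h: ring_hom_ring P K h by (rule ring_hom_ringI2[OF assms(1,2) h])
  interpret p: ring_hom_ring P F \<psi> by (rule ring_hom_ringI2[OF assms(1,3) \<psi>])
  define \<theta> where "\<theta> y = \<psi> (inv_into (carrier P) h y)" for y
  show \<theta>: "\<theta> (h f) = \<psi> f" if f: "f \<in> carrier P" for f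
  proof -
    let ?g = "inv_into (carrier P) h (h f)"
    have g: "?g \<in> carrier P" "h ?g = h f" using f by (auto simp: inv_into_into f_inv_into_f)
    then have "h (?g \<ominus>\<^bsub>P\<^esub> f) = \<zero>\<^bsub>K\<^esub>" using f by (simp add: h.R.minus_eq h.S.r_neg)
    then have "\<psi> (?g \<ominus>\<^bsub>P\<^esub> f) = \<zero>\<^bsub>F\<^esub>" using f g by (intro ker) simp_all
    then have "\<psi> ?g \<ominus>\<^bsub>F\<^esub> \<psi> f = \<zero>\<^bsub>F\<^esub>" using f g by (simp add: h.R.minus_eq p.S.minus_eq)
    then show ?thesis using f g by (simp add: \<theta>_def p.S.r_right_minus_eq)
  qed
  show "\<theta> \<in> ring_hom (K\<lparr>carrier := h ` carrier P\<rparr>) F"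
  proof (rule ring_hom_memI)
    fix x y assume "x \<in> carrier (K\<lparr>carrier := h ` carrier P\<rparr>)" "y \<in> carrier (K\<lparr>carrier := h ` carrier P\<rparr>)"
    then obtain f g where fg: "f \<in> carrier P" "g \<in> carrier P" and x: "x = h f" and y: "y = h g" by auto
    show "\<theta> x \<in> carrier F" using fg by (simp add: x \<theta>)
    show "\<theta> (x \<otimes>\<^bsub>K\<lparr>carrier := h ` carrier P\<rparr>\<^esub> y) = \<theta> x \<otimes>\<^bsub>F\<^esub> \<theta> y"
      using fg \<theta>[of "f \<otimes>\<^bsub>P\<^esub> g"] by (simp add: x y \<theta>)
    show "\<theta> (x \<oplus>\<^bsub>K\<lparr>carrier := h ` carrier P\<rparr>\<^esub> y) = \<theta> x \<oplus>\<^bsub>F\<^esub> \<theta> y"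
      using fg \<theta>[of "f \<oplus>\<^bsub>P\<^esub> g"] by (simp add: x y \<theta>)
  next
    show "\<theta> \<one>\<^bsub>K\<lparr>carrier := h ` carrier P\<rparr>\<^esub> = \<one>\<^bsub>F\<^esub>"
      using \<theta>[of "\<one>\<^bsub>P\<^esub>"] by simp
  qed
qed

text \<open>
  The extension of \<open>\<phi>\<close> applies \<open>\<phi>\<close> to the coefficients and then reduces modulo the image of \<open>q\<close>.
\<close>

lemma (in UP_cring) extend_specialization:
  fixes F :: "('f, 'h) ring_scheme"
  assumes F: "cring F" "finite (carrier F)" "\<one>\<^bsub>F\<^esub> \<noteq> \<zero>\<^bsub>F\<^esub>" and \<phi>: "\<phi> \<in> ring_hom R F"
    and q: "q \<in> carrier P" "deg R q > 0" and unit: "\<phi> (lcoeff q) \<in> Units F"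
  obtains Q :: "(nat \<Rightarrow> 'f) set ring" and \<psi> where
    "cring Q" "finite (carrier Q)" "\<one>\<^bsub>Q\<^esub> \<noteq> \<zero>\<^bsub>Q\<^esub>" "\<psi> \<in> ring_hom P Q" "\<psi> q = \<zero>\<^bsub>Q\<^esub>"
    "\<And>c. c \<in> carrier R \<Longrightarrow> \<phi> c \<in> Units F \<Longrightarrow> \<psi> (up_ring.monom P c 0) \<in> Units Q"
proof -
  define m where "m = (\<lambda>(p :: nat \<Rightarrow> 'a) n. \<phi> (p n))"
  have m: "m \<in> ring_hom P (UP F)"
    unfolding m_def P_def by (rule UP_map_hom(1)[OF R.is_cring F(1) \<phi>])
  have co: "up_ring.coeff (UP F) (m p) n = \<phi> (up_ring.coeff P p n)" if "p \<in> carrier P" for p n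
    using that UP_map_hom(2)[OF R.is_cring F(1) \<phi>] unfolding m_def P_def by blast
  interpret hom: ring_hom_cring R F \<phi>
    by (rule ring_hom_cring.intro[OF R.is_cring F(1)], rule ring_hom_cring_axioms.intro[OF \<phi>])
  interpret B: UP_cring F "UP F" by (rule UP_cring.intro, rule F(1), rule reflexive)
  have mcl: "m p \<in> carrier (UP F)" if "p \<in> carrier P" for p using ring_hom_memE(1)[OF m] that .
  have "\<phi> (lcoeff q) \<noteq> \<zero>\<^bsub>F\<^esub>" using unit F(3) 
    by (metis hom.S.Units_l_inv_ex hom.S.r_null)
  have "deg F (m q) = deg R q"
  proof (rule antisym)
    show "deg F (m q) \<le> deg R q"
      by (rule B.deg_aboveI) (use q mcl in \<open>simp_all add: co deg_aboveD\<close>)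
    show "deg R q \<le> deg F (m q)"
      by (rule B.deg_belowI) (use q mcl \<open>\<phi> (lcoeff q) \<noteq> \<zero>\<^bsub>F\<^esub>\<close> in \<open>simp_all add: co\<close>)
  qed
  then have mq: "m q \<in> carrier (UP F)" "deg F (m q) > 0" "up_ring.coeff (UP F) (m q) (deg F (m q)) \<in> Units F"
    using q unit mcl co by auto
  define I where "I = PIdl\<^bsub>UP F\<^esub> (m q)"
  interpret I: ideal I "UP F" unfolding I_def using mq(1) by (rule B.P.cgenideal_ideal)
  define \<psi> where "\<psi> p = I +>\<^bsub>UP F\<^esub> m p" for p
  have \<psi>_comp: "\<psi> = (\<lambda>x. I +>\<^bsub>UP F\<^esub> x) \<circ> m" by (auto simp: \<psi>_def)
  show thesis
  proof (rule that[of "UP F Quot I" \<psi>])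
    show "cring (UP F Quot I)" by (rule I.quotient_is_cring[OF B.P.is_cring])
    show "finite (carrier (UP F Quot I))" "\<one>\<^bsub>UP F Quot I\<^esub> \<noteq> \<zero>\<^bsub>UP F Quot I\<^esub>"
      unfolding I_def using B.quotient_by_unit_lcoeff[OF mq F(2,3)] by blast+
    show "\<psi> \<in> ring_hom P (UP F Quot I)" unfolding \<psi>_comp by (rule ring_hom_trans[OF m I.rcos_ring_hom])
    have "m q \<in> I" unfolding I_def using mq(1) by (rule B.P.cgenideal_self)
    then show "\<psi> q = \<zero>\<^bsub>UP F Quot I\<^esub>"
      unfolding \<psi>_def FactRing_def by (simp add: I.a_rcos_const)
    fix c assume c: "c \<in> carrier R" "\<phi> c \<in> Units F"
    have "m (up_ring.monom P c 0) = up_ring.monom (UP F) (\<phi> c) 0"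
      by (rule B.up_eqI) (use c mcl in \<open>simp_all add: co\<close>)
    then show "\<psi> (up_ring.monom P c 0) \<in> Units (UP F Quot I)"
      unfolding \<psi>_def using ring_hom_Units[OF B.const_ring_hom c(2)]
      by (simp add: ring_hom_Units[OF I.rcos_ring_hom])
  qed
qed

section \<open>Adjoining one element to a domain\<close>

lemma (in domain) nat_pow_nonzero:
  assumes "x \<in> carrier R" "x \<noteq> \<zero>"
  shows "x [^] (n :: nat) \<noteq> \<zero>"
  using assms by (induction n) (simp_all add: integral_iff)

text \<open>
  The transcendental case.  The elements of the image are polynomials \<open>f\<close> in one variable, and \<open>f\<close>
  is a unit modulo \<open>X f + 1\<close>, whose leading coefficient is that of \<open>f\<close>.
\<close>

lemma (in UP_domain) specializable_image_of_injective:
  fixes K :: "('f, 'h) ring_scheme"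
  assumes S: "finitely_specializable R" and K: "domain K" and ev: "ev \<in> ring_hom P K"
    and inj: "\<And>f. f \<in> carrier P \<Longrightarrow> ev f = \<zero>\<^bsub>K\<^esub> \<Longrightarrow> f = \<zero>\<^bsub>P\<^esub>"
  shows "finitely_specializable (K\<lparr>carrier := ev ` carrier P\<rparr>)"
proof (rule finitely_specializableI)
  fix d assume "d \<in> carrier (K\<lparr>carrier := ev ` carrier P\<rparr>)" "d \<noteq> \<zero>\<^bsub>K\<lparr>carrier := ev ` carrier P\<rparr>\<^esub>"
  then obtain f where f: "f \<in> carrier P" and d: "d = ev f" "ev f \<noteq> \<zero>\<^bsub>K\<^esub>" by auto
  interpret K: domain K by (rule K)
  interpret ev: ring_hom_ring P K ev by (rule ring_hom_ringI2[OF P.ring_axioms K.ring_axioms ev])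
  have f0: "f \<noteq> \<zero>\<^bsub>P\<^esub>" using d by auto
  let ?x = "up_ring.monom P \<one> 1"
  define q where "q = ?x \<otimes>\<^bsub>P\<^esub> f \<oplus>\<^bsub>P\<^esub> \<one>\<^bsub>P\<^esub>"
  have q: "q \<in> carrier P" using f by (simp add: q_def)
  have "?x \<noteq> \<zero>\<^bsub>P\<^esub>"
  proof
    assume "?x = \<zero>\<^bsub>P\<^esub>"
    then have "up_ring.coeff P ?x 1 = \<zero>" by simp
    then show False by simp
  qed
  then have "deg R (?x \<otimes>\<^bsub>P\<^esub> f) = Suc (deg R f)" using f f0 deg_monom[of \<one> 1] by simp
  then have "deg R q \<le> Suc (deg R f)"
    using deg_add[of "?x \<otimes>\<^bsub>P\<^esub> f" "\<one>\<^bsub>P\<^esub>"] f by (simp add: q_def)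
  moreover have top: "up_ring.coeff P q (Suc (deg R f)) = lcoeff f"
    using coeff_monom_mult[of \<one> f 1 "deg R f"] f by (simp add: q_def del: coeff_mult)
  then have "Suc (deg R f) \<le> deg R q"
    using lcoeff_nonzero[OF f0 f] q by (intro deg_belowI) simp_all
  ultimately have deg_q: "deg R q = Suc (deg R f)" by simp
  have "lcoeff f \<in> carrier R - {\<zero>}" using f lcoeff_nonzero[OF f0 f] by simp
  then obtain F :: "nat ring" and \<phi> where F: "cring F" "finite (carrier F)" "\<one>\<^bsub>F\<^esub> \<noteq> \<zero>\<^bsub>F\<^esub>"
    and \<phi>: "\<phi> \<in> ring_hom R F" "\<phi> (lcoeff f) \<in> Units F"
    using S unfolding finitely_specializable_def by blast
  have "\<phi> (lcoeff q) \<in> Units F" using \<phi>(2) top deg_q by simp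
  then obtain Q :: "(nat \<Rightarrow> nat) set ring" and \<psi> where
    Q: "cring Q" "finite (carrier Q)" "\<one>\<^bsub>Q\<^esub> \<noteq> \<zero>\<^bsub>Q\<^esub>" and \<psi>: "\<psi> \<in> ring_hom P Q" "\<psi> q = \<zero>\<^bsub>Q\<^esub>"
    using extend_specialization[OF F \<phi>(1) q] deg_q by (metis zero_less_Suc)
  interpret Q: cring Q by (rule Q)
  interpret \<psi>: ring_hom_ring P Q \<psi> by (rule ring_hom_ringI2[OF P.ring_axioms Q.ring_axioms \<psi>(1)])
  have "\<psi> ?x \<otimes>\<^bsub>Q\<^esub> \<psi> f \<oplus>\<^bsub>Q\<^esub> \<one>\<^bsub>Q\<^esub> = \<zero>\<^bsub>Q\<^esub>" using \<psi>(2) f by (simp add: q_def)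
  then have "(\<ominus>\<^bsub>Q\<^esub> \<psi> ?x) \<otimes>\<^bsub>Q\<^esub> \<psi> f = \<one>\<^bsub>Q\<^esub>"
    using f by (simp add: Q.l_minus Q.minus_equality Q.a_comm)
  then have unit: "\<psi> f \<in> Units Q"
    using f Q.m_comm[of "\<ominus>\<^bsub>Q\<^esub> \<psi> ?x" "\<psi> f"] unfolding Units_def 
    by (auto intro!: bexI[of _ "\<ominus>\<^bsub>Q\<^esub> \<psi> ?x"])
  obtain \<theta> where "\<theta> \<in> ring_hom (K\<lparr>carrier := ev ` carrier P\<rparr>) Q"
    and "\<And>f. f \<in> carrier P \<Longrightarrow> \<theta> (ev f) = \<psi> f"
    using hom_factors_through_image[OF P.ring_axioms K.ring_axioms Q.ring_axioms ev \<psi>(1)] inj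
    by (metis \<psi>.hom_zero)
  then show "\<exists>(Q :: (nat \<Rightarrow> nat) set ring) \<theta>. cring Q \<and> finite (carrier Q) \<and> \<one>\<^bsub>Q\<^esub> \<noteq> \<zero>\<^bsub>Q\<^esub> \<and>
      \<theta> \<in> ring_hom (K\<lparr>carrier := ev ` carrier P\<rparr>) Q \<and> \<theta> d \<in> Units Q"
    using Q unit f d(1) by metis
qed

text \<open>
  Over the fraction field, \<open>ev f\<close> is invertible because \<open>p\<close> makes the ring of values finite
  dimensional.  Without fractions: let \<open>r\<close> have least degree among the polynomials whose value is a
  nonzero multiple of \<open>ev f\<close>.  Pseudo-division of \<open>r\<close> by \<open>p\<close> shows that \<open>r\<close> has smaller degree than
  \<open>p\<close>.  Pseudo-division of \<open>p\<close> by \<open>r\<close> leaves a remainder whose value is a multiple of \<open>ev f\<close>, hence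
  zero by the choice of \<open>r\<close>, and then the remainder is zero by the choice of \<open>p\<close>.  So a constant
  multiple of \<open>p\<close> is \<open>r g\<close>, where \<open>g\<close> has value zero and therefore at least the degree of \<open>p\<close>.  It
  follows that \<open>r\<close> is constant.
\<close>

lemma (in UP_domain) constant_multiple_of_algebraic_value:
  fixes K :: "('f, 'h) ring_scheme"
  assumes K: "domain K" and ev: "ev \<in> ring_hom P K"
    and const: "\<And>c. c \<in> carrier R \<Longrightarrow> ev (up_ring.monom P c 0) = \<zero>\<^bsub>K\<^esub> \<Longrightarrow> c = \<zero>"
    and p: "p \<in> carrier P" "p \<noteq> \<zero>\<^bsub>P\<^esub>" "ev p = \<zero>\<^bsub>K\<^esub>"
    and min: "\<And>s. s \<in> carrier P \<Longrightarrow> ev s = \<zero>\<^bsub>K\<^esub> \<Longrightarrow> deg R s < deg R p \<Longrightarrow> s = \<zero>\<^bsub>P\<^esub>"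
    and f: "f \<in> carrier P" "ev f \<noteq> \<zero>\<^bsub>K\<^esub>"
  obtains e c where "e \<in> carrier P" "c \<in> carrier R" "c \<noteq> \<zero>"
    "ev (f \<otimes>\<^bsub>P\<^esub> e) = ev (up_ring.monom P c 0)"
proof -
  interpret K: domain K by (rule K)
  interpret ev: ring_hom_ring P K ev by (rule ring_hom_ringI2[OF P.ring_axioms K.ring_axioms ev])
  have ev_smult: "ev (a \<odot>\<^bsub>P\<^esub> g) = ev (up_ring.monom P a 0) \<otimes>\<^bsub>K\<^esub> ev g"
    if "a \<in> carrier R" "g \<in> carrier P" for a g
    using that by (metis ev.hom_mult monom_closed monom_mult_is_smult)
  define M where "M = {r \<in> carrier P. ev r \<noteq> \<zero>\<^bsub>K\<^esub> \<and> (\<exists>e\<in>carrier P. ev r = ev (f \<otimes>\<^bsub>P\<^esub> e))}"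
  have "f \<in> M" using f by (auto simp: M_def intro!: bexI[of _ "\<one>\<^bsub>P\<^esub>"])
  then obtain r where rM: "r \<in> M" and rmin: "\<And>s. s \<in> M \<Longrightarrow> deg R r \<le> deg R s"
    using ex_has_least_nat[of "\<lambda>r. r \<in> M" f "deg R"] by blast
  obtain e where r: "r \<in> carrier P" "ev r \<noteq> \<zero>\<^bsub>K\<^esub>" and e: "e \<in> carrier P" "ev r = ev (f \<otimes>\<^bsub>P\<^esub> e)"
    using rM unfolding M_def by blast
  have r0: "r \<noteq> \<zero>\<^bsub>P\<^esub>" using r by auto
  have small: "deg R r < deg R p"
  proof -
    obtain g s and n :: nat where g: "g \<in> carrier P" and s: "s \<in> carrier P"
      and div: "lcoeff p [^] n \<odot>\<^bsub>P\<^esub> r = p \<otimes>\<^bsub>P\<^esub> g \<oplus>\<^bsub>P\<^esub> s"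
      and deg_s: "s = \<zero>\<^bsub>P\<^esub> \<or> deg R s < deg R p"
      using long_div_theorem[OF p(1) r(1) p(2)] by blast
    let ?a = "lcoeff p [^] n"
    have a: "?a \<in> carrier R" "?a \<noteq> \<zero>"
      using p lcoeff_nonzero[OF p(2,1)] by (simp_all add: R.nat_pow_nonzero)
    have "ev s = ev (?a \<odot>\<^bsub>P\<^esub> r)" using div p g s by simp
    then have ev_s: "ev s = ev (up_ring.monom P ?a 0) \<otimes>\<^bsub>K\<^esub> ev r" using ev_smult a r by simp
    then have "ev s \<noteq> \<zero>\<^bsub>K\<^esub>" using a r const[OF a(1)] by (auto simp: K.integral_iff)
    moreover have "ev s = ev (f \<otimes>\<^bsub>P\<^esub> (?a \<odot>\<^bsub>P\<^esub> e))"
      using ev_s a e f by (simp add: ev_smult K.m_lcomm)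
    ultimately have "s \<in> M" using s a e by (auto simp: M_def)
    then show ?thesis using rmin[of s] deg_s \<open>ev s \<noteq> \<zero>\<^bsub>K\<^esub>\<close> by auto
  qed
  have "deg R r = 0"
  proof -
    obtain g s and n :: nat where g: "g \<in> carrier P" and s: "s \<in> carrier P"
      and div: "lcoeff r [^] n \<odot>\<^bsub>P\<^esub> p = r \<otimes>\<^bsub>P\<^esub> g \<oplus>\<^bsub>P\<^esub> s"
      and deg_s: "s = \<zero>\<^bsub>P\<^esub> \<or> deg R s < deg R r"
      using long_div_theorem[OF r(1) p(1) r0] by blast
    let ?a = "lcoeff r [^] n"
    have a: "?a \<in> carrier R" "?a \<noteq> \<zero>"
      using r lcoeff_nonzero[OF r0 r(1)] by (simp_all add: R.nat_pow_nonzero)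
    have "ev (?a \<odot>\<^bsub>P\<^esub> p) = \<zero>\<^bsub>K\<^esub>" using ev_smult a p by simp
    then have sum: "ev r \<otimes>\<^bsub>K\<^esub> ev g \<oplus>\<^bsub>K\<^esub> ev s = \<zero>\<^bsub>K\<^esub>" using div r g s by simp
    have "ev s = \<ominus>\<^bsub>K\<^esub> (ev r \<otimes>\<^bsub>K\<^esub> ev g)"
      using sum r g s by (metis K.minus_equality K.a_comm K.m_closed ev.hom_closed K.minus_minus)
    also have "\<dots> = ev (f \<otimes>\<^bsub>P\<^esub> (\<ominus>\<^bsub>P\<^esub> (e \<otimes>\<^bsub>P\<^esub> g)))"
      using e f g by (simp add: K.m_assoc K.r_minus)
    finally have "ev s = ev (f \<otimes>\<^bsub>P\<^esub> (\<ominus>\<^bsub>P\<^esub> (e \<otimes>\<^bsub>P\<^esub> g)))" .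
    moreover have "\<ominus>\<^bsub>P\<^esub> (e \<otimes>\<^bsub>P\<^esub> g) \<in> carrier P" using e g by simp
    ultimately have "ev s = \<zero>\<^bsub>K\<^esub>"
      using rmin[of s] s deg_s unfolding M_def by fastforce
    then have s0: "s = \<zero>\<^bsub>P\<^esub>" using min[OF s] deg_s small by auto
    have "ev g = \<zero>\<^bsub>K\<^esub>" using sum \<open>ev s = \<zero>\<^bsub>K\<^esub>\<close> r g K.integral_iff by simp
    have eq: "?a \<odot>\<^bsub>P\<^esub> p = r \<otimes>\<^bsub>P\<^esub> g" using div s0 r g by simp
    have "g \<noteq> \<zero>\<^bsub>P\<^esub>"
    proof
      assume "g = \<zero>\<^bsub>P\<^esub>"
      then have "up_ring.coeff P (?a \<odot>\<^bsub>P\<^esub> p) (deg R p) = \<zero>" using eq r by simp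
      then show False using a p lcoeff_nonzero[OF p(2,1)] R.integral_iff by simp
    qed
    then have "deg R p \<le> deg R g" using min[OF g \<open>ev g = \<zero>\<^bsub>K\<^esub>\<close>] by force
    moreover have "deg R r + deg R g \<le> deg R p"
      using deg_smult_decr[OF a(1) p(1)] r0 \<open>g \<noteq> \<zero>\<^bsub>P\<^esub>\<close> r g by (simp add: eq)
    ultimately show ?thesis by simp
  qed
  then have r_const: "r = up_ring.monom P (up_ring.coeff P r 0) 0" using r by (intro deg_zero_impl_monom)
  show thesis
  proof (rule that[OF e(1)])
    show "up_ring.coeff P r 0 \<in> carrier R" using r by simp
    show "up_ring.coeff P r 0 \<noteq> \<zero>" using lcoeff_nonzero[OF r0 r(1)] \<open>deg R r = 0\<close> by simp
    show "ev (f \<otimes>\<^bsub>P\<^esub> e) = ev (up_ring.monom P (up_ring.coeff P r 0) 0)" using e(2) r_const by simp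
  qed
qed

text \<open>
  Two elements of the coefficient ring have to become units: the leading coefficient of \<open>p\<close>, so that
  the quotient modulo \<open>p\<close> is finite and kills the whole kernel of \<open>ev\<close>, and the constant multiple of
  the given value.  Their product is nonzero, so one specialization achieves both.
\<close>

lemma (in UP_domain) specializable_image_of_algebraic:
  fixes K :: "('f, 'h) ring_scheme"
  assumes S: "finitely_specializable R" and K: "domain K" and ev: "ev \<in> ring_hom P K"
    and const: "\<And>c. c \<in> carrier R \<Longrightarrow> ev (up_ring.monom P c 0) = \<zero>\<^bsub>K\<^esub> \<Longrightarrow> c = \<zero>"
    and p: "p \<in> carrier P" "p \<noteq> \<zero>\<^bsub>P\<^esub>" "ev p = \<zero>\<^bsub>K\<^esub>"
    and min: "\<And>s. s \<in> carrier P \<Longrightarrow> ev s = \<zero>\<^bsub>K\<^esub> \<Longrightarrow> deg R s < deg R p \<Longrightarrow> s = \<zero>\<^bsub>P\<^esub>"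
  shows "finitely_specializable (K\<lparr>carrier := ev ` carrier P\<rparr>)"
proof (rule finitely_specializableI)
  fix d assume "d \<in> carrier (K\<lparr>carrier := ev ` carrier P\<rparr>)" "d \<noteq> \<zero>\<^bsub>K\<lparr>carrier := ev ` carrier P\<rparr>\<^esub>"
  then obtain f where f: "f \<in> carrier P" "ev f \<noteq> \<zero>\<^bsub>K\<^esub>" and d: "d = ev f" by auto
  interpret K: domain K by (rule K)
  interpret ev: ring_hom_ring P K ev by (rule ring_hom_ringI2[OF P.ring_axioms K.ring_axioms ev])
  obtain e c where e: "e \<in> carrier P" and c: "c \<in> carrier R" "c \<noteq> \<zero>"
    and ec: "ev (f \<otimes>\<^bsub>P\<^esub> e) = ev (up_ring.monom P c 0)"
    by (rule constant_multiple_of_algebraic_value[OF K ev const p min f]) blast+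
  have deg_p: "deg R p > 0"
  proof (rule ccontr)
    assume "\<not> deg R p > 0"
    then have "p = up_ring.monom P (lcoeff p) 0" using deg_zero_impl_monom[OF p(1)] by simp
    then have "lcoeff p = \<zero>" using const[of "lcoeff p"] p by simp
    then show False using lcoeff_nonzero[OF p(2,1)] by simp
  qed
  have "lcoeff p \<otimes> c \<in> carrier R - {\<zero>}"
    using p c lcoeff_nonzero[OF p(2,1)] by (simp add: R.integral_iff)
  then obtain F :: "nat ring" and \<phi> where F: "cring F" "finite (carrier F)" "\<one>\<^bsub>F\<^esub> \<noteq> \<zero>\<^bsub>F\<^esub>"
    and \<phi>: "\<phi> \<in> ring_hom R F" "\<phi> (lcoeff p \<otimes> c) \<in> Units F"
    using S unfolding finitely_specializable_def by blast
  interpret F: cring F by (rule F)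
  interpret \<phi>: ring_hom_cring R F \<phi>
    by (rule ring_hom_cring.intro[OF R.is_cring F(1)], rule ring_hom_cring_axioms.intro[OF \<phi>(1)])
  have units: "\<phi> (lcoeff p) \<in> Units F" "\<phi> c \<in> Units F"
    using \<phi>(2) p c F.unit_factor[of "\<phi> (lcoeff p)" "\<phi> c"] F.unit_factor[of "\<phi> c" "\<phi> (lcoeff p)"]
    by (simp_all add: F.m_comm)
  obtain Q :: "(nat \<Rightarrow> nat) set ring" and \<psi> where
    Q: "cring Q" "finite (carrier Q)" "\<one>\<^bsub>Q\<^esub> \<noteq> \<zero>\<^bsub>Q\<^esub>" and \<psi>: "\<psi> \<in> ring_hom P Q" "\<psi> p = \<zero>\<^bsub>Q\<^esub>"
    and \<psi>_const: "\<And>a. a \<in> carrier R \<Longrightarrow> \<phi> a \<in> Units F \<Longrightarrow> \<psi> (up_ring.monom P a 0) \<in> Units Q"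
    using extend_specialization[OF F \<phi>(1) p(1) deg_p units(1)] by metis
  interpret Q: cring Q by (rule Q)
  interpret \<psi>: ring_hom_ring P Q \<psi> by (rule ring_hom_ringI2[OF P.ring_axioms Q.ring_axioms \<psi>(1)])
  have ker: "\<psi> h = \<zero>\<^bsub>Q\<^esub>" if h: "h \<in> carrier P" "ev h = \<zero>\<^bsub>K\<^esub>" for h
  proof -
    obtain g s and n :: nat where g: "g \<in> carrier P" and s: "s \<in> carrier P"
      and div: "lcoeff p [^] n \<odot>\<^bsub>P\<^esub> h = p \<otimes>\<^bsub>P\<^esub> g \<oplus>\<^bsub>P\<^esub> s"
      and deg_s: "s = \<zero>\<^bsub>P\<^esub> \<or> deg R s < deg R p"
      using long_div_theorem[OF p(1) h(1) p(2)] by blast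
    let ?a = "up_ring.monom P (lcoeff p [^] n) 0"
    have a: "?a \<in> carrier P" using p by simp
    have div': "?a \<otimes>\<^bsub>P\<^esub> h = p \<otimes>\<^bsub>P\<^esub> g \<oplus>\<^bsub>P\<^esub> s"
      using p h by (simp add: monom_mult_is_smult div)
    have "ev (?a \<otimes>\<^bsub>P\<^esub> h) = \<zero>\<^bsub>K\<^esub>" using a h by simp
    then have "ev s = \<zero>\<^bsub>K\<^esub>" using p g s unfolding div' by simp
    then have "s = \<zero>\<^bsub>P\<^esub>" using min[OF s] deg_s by blast
    then have "\<psi> (?a \<otimes>\<^bsub>P\<^esub> h) = \<zero>\<^bsub>Q\<^esub>" using \<psi>(2) p g unfolding div' by simp
    then have "\<psi> ?a \<otimes>\<^bsub>Q\<^esub> \<psi> h = \<psi> ?a \<otimes>\<^bsub>Q\<^esub> \<zero>\<^bsub>Q\<^esub>" using a h by simp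
    moreover have "\<psi> ?a \<in> Units Q"
      using units(1) p by (intro \<psi>_const) (simp_all add: F.Units_pow_closed)
    ultimately show ?thesis using h Q.Units_l_cancel[of "\<psi> ?a" "\<psi> h" "\<zero>\<^bsub>Q\<^esub>"] by simp
  qed
  obtain \<theta> where \<theta>: "\<theta> \<in> ring_hom (K\<lparr>carrier := ev ` carrier P\<rparr>) Q"
    and \<theta>_ev: "\<And>f. f \<in> carrier P \<Longrightarrow> \<theta> (ev f) = \<psi> f"
    using hom_factors_through_image[OF P.ring_axioms K.ring_axioms Q.ring_axioms ev \<psi>(1)] ker by metis
  have "\<psi> f \<otimes>\<^bsub>Q\<^esub> \<psi> e = \<theta> (ev (f \<otimes>\<^bsub>P\<^esub> e))" using f e \<theta>_ev[of "f \<otimes>\<^bsub>P\<^esub> e"] by simp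
  also have "\<dots> = \<psi> (up_ring.monom P c 0)" unfolding ec using c by (intro \<theta>_ev) simp
  finally have "\<psi> f \<otimes>\<^bsub>Q\<^esub> \<psi> e \<in> Units Q" using \<psi>_const[OF c(1) units(2)] by simp
  then have "\<theta> d \<in> Units Q" using Q.unit_factor[of "\<psi> f" "\<psi> e"] f e \<theta>_ev[OF f(1)] d by simp
  then show "\<exists>(Q :: (nat \<Rightarrow> nat) set ring) \<theta>. cring Q \<and> finite (carrier Q) \<and> \<one>\<^bsub>Q\<^esub> \<noteq> \<zero>\<^bsub>Q\<^esub> \<and>
      \<theta> \<in> ring_hom (K\<lparr>carrier := ev ` carrier P\<rparr>) Q \<and> \<theta> d \<in> Units Q"
    using Q \<theta> by blast
qed

lemma (in UP_domain) specializable_image: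
  fixes K :: "('f, 'h) ring_scheme"
  assumes "finitely_specializable R" "domain K" "ev \<in> ring_hom P K"
    and "\<And>c. c \<in> carrier R \<Longrightarrow> ev (up_ring.monom P c 0) = \<zero>\<^bsub>K\<^esub> \<Longrightarrow> c = \<zero>"
  shows "finitely_specializable (K\<lparr>carrier := ev ` carrier P\<rparr>)"
proof (cases "\<exists>p. p \<in> carrier P \<and> p \<noteq> \<zero>\<^bsub>P\<^esub> \<and> ev p = \<zero>\<^bsub>K\<^esub>")
  case False
  then show ?thesis by (intro specializable_image_of_injective[OF assms(1-3)]) blast
next
  case True
  then obtain p where "p \<in> carrier P" "p \<noteq> \<zero>\<^bsub>P\<^esub>" "ev p = \<zero>\<^bsub>K\<^esub>"
    and "\<And>s. s \<in> carrier P \<and> s \<noteq> \<zero>\<^bsub>P\<^esub> \<and> ev s = \<zero>\<^bsub>K\<^esub> \<Longrightarrow> deg R p \<le> deg R s"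
    using ex_has_least_nat[of "\<lambda>p. p \<in> carrier P \<and> p \<noteq> \<zero>\<^bsub>P\<^esub> \<and> ev p = \<zero>\<^bsub>K\<^esub>" _ "deg R"] by blast
  then show ?thesis by (intro specializable_image_of_algebraic[OF assms, of p]) (auto simp: not_le[symmetric])
qed

lemma (in domain) specializable_adjoin:
  assumes C: "subring C R" "finitely_specializable (R\<lparr>carrier := C\<rparr>)" and x: "x \<in> carrier R"
  obtains C' where "subring C' R" "finitely_specializable (R\<lparr>carrier := C'\<rparr>)" "C \<subseteq> C'" "x \<in> C'"
proof -
  let ?S = "R\<lparr>carrier := C\<rparr>"
  have S: "domain ?S" by (rule subring_is_domain[OF C(1)])
  have id: "id \<in> ring_hom ?S R" using subringE(1)[OF C(1)] by (intro ring_hom_memI) auto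
  interpret S: UP_domain ?S "UP ?S" by (rule UP_domain.intro, rule S, rule reflexive)
  interpret ev: UP_pre_univ_prop ?S R id "UP ?S"
    by (rule UP_pre_univ_propI[OF S.R.is_cring is_cring id], rule reflexive)
  define ev where "ev = UnivPoly.eval ?S R id x"
  have ev: "ev \<in> ring_hom (UP ?S) R" unfolding ev_def using x by (rule ev.eval_ring_hom)
  have const: "ev (up_ring.monom (UP ?S) c 0) = c" if "c \<in> C" for c
    unfolding ev_def using ev.eval_const[OF x, of c] that by simp
  interpret h: ring_hom_ring "UP ?S" R ev by (rule ring_hom_ringI2[OF S.P.ring_axioms ring_axioms ev])
  show thesis
  proof (rule that)
    show "subring (ev ` carrier (UP ?S)) R"
      by (rule h.img_is_subring[OF S.P.carrier_is_subring])
    show "finitely_specializable (R\<lparr>carrier := ev ` carrier (UP ?S)\<rparr>)"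
      by (rule S.specializable_image[OF C(2) domain_axioms ev]) (simp add: const)
    show "C \<subseteq> ev ` carrier (UP ?S)"
    proof
      fix c assume c: "c \<in> C"
      then have "up_ring.monom (UP ?S) c 0 \<in> carrier (UP ?S)" by (intro S.monom_closed) simp
      then show "c \<in> ev ` carrier (UP ?S)" using const[OF c] by (metis imageI)
    qed
    have "up_ring.monom (UP ?S) \<one>\<^bsub>?S\<^esub> 1 \<in> carrier (UP ?S)" by (rule S.monom_closed) (rule S.R.one_closed)
    then show "x \<in> ev ` carrier (UP ?S)" using ev.eval_monom1[OF x] unfolding ev_def by (metis imageI)
  qed
qed

text \<open>
  The base of the induction.  In positive characteristic the prime ring is a finite domain, hence a
  field.  Otherwise it is a copy of the integers, and an integer \<open>z \<noteq> 0\<close> is a unit modulo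
  \<open>\<bar>z\<bar> + 1\<close>.
\<close>

lemma (in domain) prime_ring_specializable:
  defines "Z \<equiv> range (\<lambda>z::int. [z] \<cdot> \<one>)"
  shows "subring Z R" "finitely_specializable (R\<lparr>carrier := Z\<rparr>)"
proof -
  define e where "e z = [z] \<cdot> \<one>" for z :: int
  have Z: "Z = range e" by (simp add: Z_def e_def[abs_def])
  have cl: "e z \<in> carrier R" for z by (simp add: e_def)
  have add: "e (y + z) = e y \<oplus> e z" for y z by (simp add: e_def add.int_pow_mult)
  have neg: "e (- z) = \<ominus> e z" for z by (simp add: e_def add.int_pow_neg)
  have one: "e 1 = \<one>" by (simp add: e_def)
  have zero: "e 0 = \<zero>" using add[of 0 0] cl[of 0] by simp
  have mult: "e (y * z) = e y \<otimes> e z" for y z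
    using add.int_pow_pow[of \<one> y z] add_pow_ldistr_int[of \<one> "e z" y]
    by (simp add: e_def mult.commute[of y z])
  have diff: "e (y - z) = \<zero> \<longleftrightarrow> e y = e z" for y z
    using add[of y "- z"] cl by (simp add: neg minus_eq[symmetric])
  show sub: "subring Z R"
  proof (rule subringI)
    show "\<one> \<in> Z" unfolding Z using one by (metis rangeI)
  qed (auto simp: Z cl simp flip: add neg mult)
  show "finitely_specializable (R\<lparr>carrier := Z\<rparr>)"
  proof (cases "\<exists>z. z \<noteq> 0 \<and> e z = \<zero>")
    case True
    then obtain n where n: "n > 0" "e n = \<zero>"
      by (metis neg minus_zero neg_0_less_iff_less not_less_iff_gr_or_eq)
    have "Z \<subseteq> e ` {0..<n}"
    proof
      fix y assume "y \<in> Z"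
      then obtain z where y: "y = e z" by (auto simp: Z)
      have "e (n * (z div n)) = \<zero>" using n cl by (simp add: mult)
      then have "e z = e (z mod n)"
        using add[of "n * (z div n)" "z mod n"] cl by simp
      then show "y \<in> e ` {0..<n}" using n y by auto
    qed
    then have fin: "finite Z" by (rule finite_subset) simp
    show ?thesis
    proof (rule finitely_specializableI)
      fix d assume "d \<in> carrier (R\<lparr>carrier := Z\<rparr>)" "d \<noteq> \<zero>\<^bsub>R\<lparr>carrier := Z\<rparr>\<^esub>"
      then have d: "d \<in> Z" "d \<noteq> \<zero>" by auto
      interpret S: domain "R\<lparr>carrier := Z\<rparr>" by (rule subring_is_domain[OF sub])
      have ZR: "y \<in> carrier R" if "y \<in> Z" for y using that cl by (auto simp: Z)
      have "inj_on (\<lambda>y. d \<otimes> y) Z" using d ZR by (auto intro!: inj_onI simp: m_lcancel)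
      moreover have "(\<lambda>y. d \<otimes> y) ` Z \<subseteq> Z" using d subringE(6)[OF sub] by auto
      ultimately have "\<one> \<in> (\<lambda>y. d \<otimes> y) ` Z"
        using endo_inj_surj[OF fin] subringE(3)[OF sub] by blast
      then obtain y where "y \<in> Z" "d \<otimes> y = \<one>" by auto
      then have "d \<in> Units (R\<lparr>carrier := Z\<rparr>)" 
        using d ZR m_comm[of d y] unfolding Units_def by auto
      moreover have "id \<in> ring_hom (R\<lparr>carrier := Z\<rparr>) (R\<lparr>carrier := Z\<rparr>)" by (rule ring_hom_memI) auto
      ultimately show "\<exists>(F :: ('a, 'b) ring_scheme) \<phi>. cring F \<and> finite (carrier F) \<and> \<one>\<^bsub>F\<^esub> \<noteq> \<zero>\<^bsub>F\<^esub> \<and>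
          \<phi> \<in> ring_hom (R\<lparr>carrier := Z\<rparr>) F \<and> \<phi> d \<in> Units F"
        using S.is_cring fin by (intro exI[of _ "R\<lparr>carrier := Z\<rparr>"] exI[of _ id]) auto
    qed
  next
    case False
    then have inj: "e y = e z \<longleftrightarrow> y = z" for y z using diff[of y z] zero by (metis eq_iff_diff_eq_0)
    show ?thesis
    proof (rule finitely_specializableI)
      fix d assume "d \<in> carrier (R\<lparr>carrier := Z\<rparr>)" "d \<noteq> \<zero>\<^bsub>R\<lparr>carrier := Z\<rparr>\<^esub>"
      then obtain z where z: "d = e z" "z \<noteq> 0" using zero by (auto simp: Z)
      define n where "n = \<bar>z\<bar> + 1"
      interpret F: residues n "residue_ring n" by (rule residues.intro) (use z in \<open>auto simp: n_def\<close>)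
      define \<phi> where "\<phi> y = inv_into UNIV e y mod n" for y
      have \<phi>: "\<phi> (e y) = y mod n" for y
        unfolding \<phi>_def using inj by (subst inv_into_f_f) (auto simp: inj_def)
      have "\<phi> \<in> ring_hom (R\<lparr>carrier := Z\<rparr>) (residue_ring n)"
        by (rule ring_hom_memI)
          (auto simp: Z \<phi> F.add_cong F.mult_cong F.one_cong simp flip: add mult one)
      moreover have "coprime z n" unfolding n_def
        by (metis coprime_abs_left_iff coprime_add_one_right)
      then have "\<phi> d \<in> Units (residue_ring n)" unfolding z \<phi> using z by (intro F.mod_in_res_units) (auto simp: n_def)
      moreover have "\<one>\<^bsub>residue_ring n\<^esub> \<noteq> \<zero>\<^bsub>residue_ring n\<^esub>" by (simp add: F.res_one_eq F.res_zero_eq)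
      ultimately show "\<exists>(F :: int ring) \<phi>. cring F \<and> finite (carrier F) \<and> \<one>\<^bsub>F\<^esub> \<noteq> \<zero>\<^bsub>F\<^esub> \<and>
          \<phi> \<in> ring_hom (R\<lparr>carrier := Z\<rparr>) F \<and> \<phi> d \<in> Units F"
        using F.cring F.finite by blast
    qed
  qed
qed

text \<open>
  Induction over the set, adjoining its elements one by one to the prime ring.
\<close>

theorem (in domain) finite_subset_in_specializable_subring:
  assumes "finite A" "A \<subseteq> carrier R"
  obtains C where "subring C R" "finitely_specializable (R\<lparr>carrier := C\<rparr>)" "A \<subseteq> C"
  using assms
proof (induction A arbitrary: thesis)
  case empty
  then show ?case using prime_ring_specializable by blast
next
  case (insert x A)
  then obtain C where C: "subring C R" "finitely_specializable (R\<lparr>carrier := C\<rparr>)" and A: "A \<subseteq> C"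
    by auto
  obtain C' where "subring C' R" "finitely_specializable (R\<lparr>carrier := C'\<rparr>)" "C \<subseteq> C'" "x \<in> C'"
    using specializable_adjoin[OF C] insert.prems(2) by auto
  then show ?case using A by (intro insert.prems(1)) auto
qed

section \<open>Matrices over a group ring as cellular automata\<close>

locale matrix_group_ring = F: ring F + G: group G for F (structure) and G (structure) +
  fixes n :: nat
begin

abbreviation M where "M \<equiv> mat_ring n (group_ring F G)"

sublocale GR: ring "group_ring F G"
  by (rule ring_group_ring[OF F.ring_axioms G.group_axioms])

sublocale MR: ring M
  by (rule ring_mat_ring[OF GR.ring_axioms])

definition supported :: "'c set \<Rightarrow> (nat \<times> nat \<Rightarrow> 'c \<Rightarrow> 'a) \<Rightarrow> bool" where
  "supported H a \<longleftrightarrow> (\<forall>i<n. \<forall>j<n. gsupp F G (a (i, j)) \<subseteq> H)"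

lemma ex_support:
  assumes "a \<in> carrier M"
  obtains H where "finite H" "H \<subseteq> carrier G" "supported H a"
proof
  let ?H = "\<Union>p\<in>{..<n} \<times> {..<n}. gsupp F G (a p)"
  show "finite ?H" using assms by (auto simp: mat_ring_def group_ring_def)
  show "?H \<subseteq> carrier G" by (auto simp: gsupp_def)
  show "supported ?H a" by (force simp: supported_def)
qed

lemma supported_mono: "supported H a \<Longrightarrow> H \<subseteq> H' \<Longrightarrow> supported H' a"
  unfolding supported_def by blast

lemma supportedD:
  "\<lbrakk>supported H a; i < n; j < n; h \<in> carrier G; h \<notin> H\<rbrakk> \<Longrightarrow> a (i, j) h = \<zero>\<^bsub>F\<^esub>"
  unfolding supported_def gsupp_def by blast

lemma entry_closed [simp]:
  "\<lbrakk>a \<in> carrier M; i < n; j < n; g \<in> carrier G\<rbrakk> \<Longrightarrow> a (i, j) g \<in> carrier F"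
  by (auto simp: mat_ring_def group_ring_def)

lemma matrixI:
  assumes "finite H" "\<And>i j g. \<lbrakk>i < n; j < n; g \<in> carrier G\<rbrakk> \<Longrightarrow> u i j g \<in> carrier F"
    and "\<And>i j g. \<lbrakk>i < n; j < n; g \<in> carrier G; g \<notin> H\<rbrakk> \<Longrightarrow> u i j g = \<zero>\<^bsub>F\<^esub>"
  shows "(\<lambda>(i, j)\<in>{..<n} \<times> {..<n}. \<lambda>g\<in>carrier G. u i j g) \<in> carrier M"
proof -
  have "finite (gsupp F G (\<lambda>g\<in>carrier G. u i j g))" if "i < n" "j < n" for i j
    by (rule finite_subset[OF _ assms(1)]) (use assms(3) that in \<open>auto simp: gsupp_def\<close>)
  then show ?thesis using assms(2) by (auto simp: mat_ring_def group_ring_def)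
qed

lemma matrix_eqI:
  assumes "a \<in> carrier M" "b \<in> carrier M"
    and eq: "\<And>i j g. \<lbrakk>i < n; j < n; g \<in> carrier G\<rbrakk> \<Longrightarrow> a (i, j) g = b (i, j) g"
  shows "a = b"
proof (rule PiE_ext)
  show "a \<in> {..<n} \<times> {..<n} \<rightarrow>\<^sub>E carrier (group_ring F G)"
    "b \<in> {..<n} \<times> {..<n} \<rightarrow>\<^sub>E carrier (group_ring F G)"
    using assms by (simp_all add: mat_ring_def)
  fix p assume p: "p \<in> {..<n} \<times> {..<n}"
  then have "a p \<in> carrier (group_ring F G)" "b p \<in> carrier (group_ring F G)"
    using assms(1,2) unfolding mat_ring_def by (auto simp del: mem_Times_iff)
  then have ab: "a p \<in> carrier G \<rightarrow>\<^sub>E carrier F" "b p \<in> carrier G \<rightarrow>\<^sub>E carrier F"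
    by (simp_all add: group_ring_def)
  show "a p = b p"
  proof (rule PiE_ext)
    show "a p \<in> carrier G \<rightarrow>\<^sub>E carrier F" "b p \<in> carrier G \<rightarrow>\<^sub>E carrier F"
      using ab by simp_all
  qed (use eq p in auto)
qed

lemma one_entry:
  "\<lbrakk>i < n; j < n; g \<in> carrier G\<rbrakk> \<Longrightarrow>
    \<one>\<^bsub>M\<^esub> (i, j) g = (if i = j \<and> g = \<one>\<^bsub>G\<^esub> then \<one>\<^bsub>F\<^esub> else \<zero>\<^bsub>F\<^esub>)"
  by (simp add: mat_ring_def group_ring_def)

lemma finsum_entry:
  assumes "finite A" "\<And>x. x \<in> A \<Longrightarrow> f x \<in> carrier (group_ring F G)" "g \<in> carrier G"
  shows "(\<Oplus>\<^bsub>group_ring F G\<^esub>x\<in>A. f x) g = (\<Oplus>\<^bsub>F\<^esub>x\<in>A. f x g)"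
  using assms(1,2)
proof (induction A)
  case empty
  then show ?case using assms(3) by (simp add: GR.finsum_empty, simp add: group_ring_def)
next
  case (insert x A)
  have cl: "f y g \<in> carrier F" if "y \<in> insert x A" for y
    using insert.prems[OF that] assms(3) by (auto simp: group_ring_def)
  have "(\<Oplus>\<^bsub>group_ring F G\<^esub>x\<in>insert x A. f x) g
      = (f x \<oplus>\<^bsub>group_ring F G\<^esub> (\<Oplus>\<^bsub>group_ring F G\<^esub>x\<in>A. f x)) g"
    using insert by (subst GR.finsum_insert) auto
  also have "\<dots> = f x g \<oplus>\<^bsub>F\<^esub> (\<Oplus>\<^bsub>group_ring F G\<^esub>x\<in>A. f x) g"
    using assms(3) by (simp add: group_ring_def)
  also have "\<dots> = (\<Oplus>\<^bsub>F\<^esub>x\<in>insert x A. f x g)"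
    using insert cl by (subst F.finsum_insert) auto
  finally show ?case .
qed

lemma mult_entry:
  assumes a: "a \<in> carrier M" and b: "b \<in> carrier M"
    and H: "finite H" "H \<subseteq> carrier G" "supported H a"
    and ij: "i < n" "j < n" and g: "g \<in> carrier G"
  shows "(a \<otimes>\<^bsub>M\<^esub> b) (i, j) g
    = (\<Oplus>\<^bsub>F\<^esub>l\<in>{..<n}. \<Oplus>\<^bsub>F\<^esub>h\<in>H. a (i, l) h \<otimes>\<^bsub>F\<^esub> b (l, j) (inv\<^bsub>G\<^esub> h \<otimes>\<^bsub>G\<^esub> g))"
proof -
  have ent: "c (i, l) \<in> carrier (group_ring F G)" if "c \<in> carrier M" "i < n" "l < n" for c i l
    using that by (auto simp: mat_ring_def)
  have "(a \<otimes>\<^bsub>M\<^esub> b) (i, j) g = (\<Oplus>\<^bsub>group_ring F G\<^esub>l\<in>{..<n}. a (i, l) \<otimes>\<^bsub>group_ring F G\<^esub> b (l, j)) g"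
    using ij by (simp add: mat_ring_def)
  also have "\<dots> = (\<Oplus>\<^bsub>F\<^esub>l\<in>{..<n}. (a (i, l) \<otimes>\<^bsub>group_ring F G\<^esub> b (l, j)) g)"
    using a b ij g ent by (intro finsum_entry) auto
  also have "\<dots> = (\<Oplus>\<^bsub>F\<^esub>l\<in>{..<n}. \<Oplus>\<^bsub>F\<^esub>h\<in>H. a (i, l) h \<otimes>\<^bsub>F\<^esub> b (l, j) (inv\<^bsub>G\<^esub> h \<otimes>\<^bsub>G\<^esub> g))"
  proof (rule F.finsum_cong'[OF refl])
    show "(\<lambda>l. \<Oplus>\<^bsub>F\<^esub>h\<in>H. a (i, l) h \<otimes>\<^bsub>F\<^esub> b (l, j) (inv\<^bsub>G\<^esub> h \<otimes>\<^bsub>G\<^esub> g)) \<in> {..<n} \<rightarrow> carrier F"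
      using a b ij g H by (auto intro!: F.finsum_closed simp: subset_iff)
    fix l assume "l \<in> {..<n}"
    then have l: "l < n" by simp
    have "(a (i, l) \<otimes>\<^bsub>group_ring F G\<^esub> b (l, j)) g
        = (\<Oplus>\<^bsub>F\<^esub>h\<in>gsupp F G (a (i, l)). a (i, l) h \<otimes>\<^bsub>F\<^esub> b (l, j) (inv\<^bsub>G\<^esub> h \<otimes>\<^bsub>G\<^esub> g))"
      using g by (simp add: group_ring_def)
    also have "\<dots> = (\<Oplus>\<^bsub>F\<^esub>h\<in>H. a (i, l) h \<otimes>\<^bsub>F\<^esub> b (l, j) (inv\<^bsub>G\<^esub> h \<otimes>\<^bsub>G\<^esub> g))"
    proof (rule F.add.finprod_mono_neutral_cong_left)
      show "gsupp F G (a (i, l)) \<subseteq> H" using H(3) ij l by (simp add: supported_def)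
      fix h assume "h \<in> H - gsupp F G (a (i, l))"
      then have "h \<in> carrier G" "a (i, l) h = \<zero>\<^bsub>F\<^esub>" using H(2) by (auto simp: gsupp_def)
      then show "a (i, l) h \<otimes>\<^bsub>F\<^esub> b (l, j) (inv\<^bsub>G\<^esub> h \<otimes>\<^bsub>G\<^esub> g) = \<zero>\<^bsub>F\<^esub>"
        using b ij l g by simp
    qed (use a b ij l g H in \<open>auto simp: subset_iff\<close>)
    finally show "(a (i, l) \<otimes>\<^bsub>group_ring F G\<^esub> b (l, j)) g
        = (\<Oplus>\<^bsub>F\<^esub>h\<in>H. a (i, l) h \<otimes>\<^bsub>F\<^esub> b (l, j) (inv\<^bsub>G\<^esub> h \<otimes>\<^bsub>G\<^esub> g))" .
  qed
  finally show ?thesis .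
qed

abbreviation vectors where "vectors \<equiv> {..<n} \<rightarrow>\<^sub>E carrier F"

text \<open>
  The matrix coefficients stand on the left and the configuration is evaluated at \<open>gh\<close>; with these
  conventions the action is compatible with multiplication and commutes with \<^const>\<open>shift\<close>, even if
  \<open>F\<close> is not commutative.  The finite set \<open>H\<close> is meant to contain the supports of the entries of \<open>a\<close>.
\<close>

definition act :: "'c set \<Rightarrow> (nat \<times> nat \<Rightarrow> 'c \<Rightarrow> 'a) \<Rightarrow> ('c \<Rightarrow> nat \<Rightarrow> 'a) \<Rightarrow> 'c \<Rightarrow> nat \<Rightarrow> 'a" where
  "act H a c = (\<lambda>g\<in>carrier G. \<lambda>i\<in>{..<n}.
     \<Oplus>\<^bsub>F\<^esub>j\<in>{..<n}. \<Oplus>\<^bsub>F\<^esub>h\<in>H. a (i, j) h \<otimes>\<^bsub>F\<^esub> c (g \<otimes>\<^bsub>G\<^esub> h) j)"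

lemma config_closed:
  "\<lbrakk>c \<in> configs G vectors; g \<in> carrier G; j < n\<rbrakk> \<Longrightarrow> c g j \<in> carrier F"
  unfolding configs_def by (meson PiE_mem lessThan_iff)

lemma config_eqI:
  assumes "c \<in> configs G vectors" "d \<in> configs G vectors"
    and "\<And>g i. \<lbrakk>g \<in> carrier G; i < n\<rbrakk> \<Longrightarrow> c g i = d g i"
  shows "c = d"
  using assms unfolding configs_def
  by (intro PiE_ext[of c _ "\<lambda>_. vectors"] PiE_ext[of _ "{..<n}" "\<lambda>_. carrier F"]) (auto dest: PiE_mem)

lemma act_closed:
  assumes "a \<in> carrier M" "H \<subseteq> carrier G" "c \<in> configs G vectors"
  shows "act H a c \<in> configs G vectors"
  using assms(1,2) config_closed[OF assms(3)]
  by (auto simp: act_def configs_def subset_iff intro!: F.finsum_closed)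

lemma act_cellular_automaton:
  assumes a: "a \<in> carrier M" and H: "finite H" "H \<subseteq> carrier G"
  shows "cellular_automaton G vectors (act H a)"
proof -
  define \<mu> where "\<mu> w = (\<lambda>i\<in>{..<n}. \<Oplus>\<^bsub>F\<^esub>j\<in>{..<n}. \<Oplus>\<^bsub>F\<^esub>h\<in>H. a (i, j) h \<otimes>\<^bsub>F\<^esub> w h j)"
    for w :: "'c \<Rightarrow> nat \<Rightarrow> 'a"
  have \<mu>: "\<mu> \<in> (H \<rightarrow>\<^sub>E vectors) \<rightarrow> vectors"
  proof
    fix w assume "w \<in> H \<rightarrow>\<^sub>E vectors"
    then have "w h j \<in> carrier F" if "h \<in> H" "j < n" for h j
      using that by (meson PiE_mem lessThan_iff)
    then show "\<mu> w \<in> vectors"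
      using a H by (auto simp: \<mu>_def subset_iff intro!: F.finsum_closed)
  qed
  have local: "act H a c g = \<mu> (restrict (shift G (inv\<^bsub>G\<^esub> g) c) H)"
    if c: "c \<in> configs G vectors" and g: "g \<in> carrier G" for c g
  proof -
    have "restrict (shift G (inv\<^bsub>G\<^esub> g) c) H h = c (g \<otimes>\<^bsub>G\<^esub> h)" if "h \<in> H" for h
      using that g H by (auto simp: shift_def)
    then have "(\<lambda>i\<in>{..<n}. \<Oplus>\<^bsub>F\<^esub>j\<in>{..<n}. \<Oplus>\<^bsub>F\<^esub>h\<in>H. a (i, j) h \<otimes>\<^bsub>F\<^esub> c (g \<otimes>\<^bsub>G\<^esub> h) j)
        = \<mu> (restrict (shift G (inv\<^bsub>G\<^esub> g) c) H)"
      unfolding \<mu>_def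
      by (intro restrict_ext F.finsum_cong' refl)
        (use a g H config_closed[OF c] in \<open>auto simp del: restrict_apply simp: subset_iff intro!: F.finsum_closed\<close>)
    then show ?thesis using g by (simp add: act_def)
  qed
  show ?thesis
    unfolding cellular_automaton_def
  proof (intro conjI exI ballI)
    show "act H a \<in> configs G vectors \<rightarrow> configs G vectors"
      by (rule funcsetI, rule act_closed[OF a H(2)])
  qed (fact H \<mu> local)+
qed

text \<open>
  Near \<open>g\<close>, a configuration is encoded as a matrix, all of whose columns are equal: the value at
  \<open>g h\<close> becomes the coefficient at the inverse of \<open>h\<close>, for \<open>h\<close> in the finite set \<open>W\<close>.  The action on
  configurations is then matrix multiplication, so that its properties follow from associativity.
\<close>

definition window :: "('c \<Rightarrow> nat \<Rightarrow> 'a) \<Rightarrow> 'c \<Rightarrow> 'c set \<Rightarrow> nat \<times> nat \<Rightarrow> 'c \<Rightarrow> 'a" where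
  "window c g W = (\<lambda>(l, m)\<in>{..<n} \<times> {..<n}. \<lambda>w\<in>carrier G.
     if inv\<^bsub>G\<^esub> w \<in> W then c (g \<otimes>\<^bsub>G\<^esub> inv\<^bsub>G\<^esub> w) l else \<zero>\<^bsub>F\<^esub>)"

lemma window_closed:
  assumes "c \<in> configs G vectors" "g \<in> carrier G" "finite W"
  shows "window c g W \<in> carrier M"
  unfolding window_def
proof (rule matrixI)
  show "finite ((\<lambda>w. inv\<^bsub>G\<^esub> w) ` W)" using assms(3) by simp
  fix w assume w: "w \<in> carrier G" "w \<notin> (\<lambda>w. inv\<^bsub>G\<^esub> w) ` W"
  then have "inv\<^bsub>G\<^esub> w \<notin> W" by (metis G.inv_inv imageI)
  then show "(if inv\<^bsub>G\<^esub> w \<in> W then c (g \<otimes>\<^bsub>G\<^esub> inv\<^bsub>G\<^esub> w) l else \<zero>\<^bsub>F\<^esub>) = \<zero>\<^bsub>F\<^esub>" for l by simp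
qed (use assms config_closed in auto)

lemma mult_window_entry:
  assumes b: "b \<in> carrier M" and H: "finite H" "H \<subseteq> carrier G" "supported H b"
    and c: "c \<in> configs G vectors" and g: "g \<in> carrier G" and h: "h \<in> carrier G"
    and W: "finite W" "\<And>h'. h' \<in> H \<Longrightarrow> h \<otimes>\<^bsub>G\<^esub> h' \<in> W" and jm: "j < n" "m < n"
  shows "(b \<otimes>\<^bsub>M\<^esub> window c g W) (j, m) (inv\<^bsub>G\<^esub> h) = act H b c (g \<otimes>\<^bsub>G\<^esub> h) j"
proof -
  have "(b \<otimes>\<^bsub>M\<^esub> window c g W) (j, m) (inv\<^bsub>G\<^esub> h) = (\<Oplus>\<^bsub>F\<^esub>l\<in>{..<n}. \<Oplus>\<^bsub>F\<^esub>h'\<in>H.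
      b (j, l) h' \<otimes>\<^bsub>F\<^esub> window c g W (l, m) (inv\<^bsub>G\<^esub> h' \<otimes>\<^bsub>G\<^esub> inv\<^bsub>G\<^esub> h))"
    using b H h jm window_closed[OF c g W(1)] by (intro mult_entry) auto
  also have "\<dots> = (\<Oplus>\<^bsub>F\<^esub>l\<in>{..<n}. \<Oplus>\<^bsub>F\<^esub>h'\<in>H. b (j, l) h' \<otimes>\<^bsub>F\<^esub> c (g \<otimes>\<^bsub>G\<^esub> h \<otimes>\<^bsub>G\<^esub> h') l)"
  proof (intro F.finsum_cong' refl)
    fix l h' assume "l \<in> {..<n}" "h' \<in> H"
    then have l: "l < n" and h': "h' \<in> carrier G" "h \<otimes>\<^bsub>G\<^esub> h' \<in> W" using H W by auto
    have "inv\<^bsub>G\<^esub> (inv\<^bsub>G\<^esub> h' \<otimes>\<^bsub>G\<^esub> inv\<^bsub>G\<^esub> h) = h \<otimes>\<^bsub>G\<^esub> h'"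
      using h h' by (simp add: G.inv_mult_group)
    then show "b (j, l) h' \<otimes>\<^bsub>F\<^esub> window c g W (l, m) (inv\<^bsub>G\<^esub> h' \<otimes>\<^bsub>G\<^esub> inv\<^bsub>G\<^esub> h)
        = b (j, l) h' \<otimes>\<^bsub>F\<^esub> c (g \<otimes>\<^bsub>G\<^esub> h \<otimes>\<^bsub>G\<^esub> h') l"
      using l jm h h' g by (simp add: window_def G.m_assoc)
  qed (use b H g h jm config_closed[OF c] in \<open>auto simp: subset_iff intro!: F.finsum_closed\<close>)
  also have "\<dots> = act H b c (g \<otimes>\<^bsub>G\<^esub> h) j" using g h jm by (simp add: act_def)
  finally show ?thesis .
qed

text \<open>
  The action is multiplicative.  It suffices that the window contains the products of two elements of
  \<open>H\<close>, because the value at \<open>g\<close> of the composite depends on \<open>c\<close> only at \<open>g h h'\<close>.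
\<close>

lemma act_act_entry:
  assumes a: "a \<in> carrier M" and b: "b \<in> carrier M"
    and H: "finite H" "H \<subseteq> carrier G" "supported H a" "supported H b"
    and c: "c \<in> configs G vectors" and g: "g \<in> carrier G"
    and W: "finite W" "\<And>h h'. h \<in> H \<Longrightarrow> h' \<in> H \<Longrightarrow> h \<otimes>\<^bsub>G\<^esub> h' \<in> W" and im: "i < n" "m < n"
  shows "act H a (act H b c) g i = ((a \<otimes>\<^bsub>M\<^esub> b) \<otimes>\<^bsub>M\<^esub> window c g W) (i, m) \<one>\<^bsub>G\<^esub>"
proof -
  let ?x = "window c g W"
  have x: "?x \<in> carrier M" by (rule window_closed[OF c g W(1)])
  have "((a \<otimes>\<^bsub>M\<^esub> b) \<otimes>\<^bsub>M\<^esub> ?x) (i, m) \<one>\<^bsub>G\<^esub> = (a \<otimes>\<^bsub>M\<^esub> (b \<otimes>\<^bsub>M\<^esub> ?x)) (i, m) \<one>\<^bsub>G\<^esub>"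
    using a b x by (simp add: MR.m_assoc)
  also have "\<dots> = (\<Oplus>\<^bsub>F\<^esub>j\<in>{..<n}. \<Oplus>\<^bsub>F\<^esub>h\<in>H.
      a (i, j) h \<otimes>\<^bsub>F\<^esub> (b \<otimes>\<^bsub>M\<^esub> ?x) (j, m) (inv\<^bsub>G\<^esub> h \<otimes>\<^bsub>G\<^esub> \<one>\<^bsub>G\<^esub>))"
    using a b x H im by (intro mult_entry) auto
  also have "\<dots> = (\<Oplus>\<^bsub>F\<^esub>j\<in>{..<n}. \<Oplus>\<^bsub>F\<^esub>h\<in>H. a (i, j) h \<otimes>\<^bsub>F\<^esub> act H b c (g \<otimes>\<^bsub>G\<^esub> h) j)"
  proof (intro F.finsum_cong' refl)
    fix j h assume "j \<in> {..<n}" "h \<in> H"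
    then have j: "j < n" and h: "h \<in> H" "h \<in> carrier G" using H by auto
    have "(b \<otimes>\<^bsub>M\<^esub> ?x) (j, m) (inv\<^bsub>G\<^esub> h) = act H b c (g \<otimes>\<^bsub>G\<^esub> h) j"
      using mult_window_entry[OF b H(1,2,4) c g h(2) W(1) _ j im(2)] W(2) h(1) by blast
    then show "a (i, j) h \<otimes>\<^bsub>F\<^esub> (b \<otimes>\<^bsub>M\<^esub> ?x) (j, m) (inv\<^bsub>G\<^esub> h \<otimes>\<^bsub>G\<^esub> \<one>\<^bsub>G\<^esub>)
        = a (i, j) h \<otimes>\<^bsub>F\<^esub> act H b c (g \<otimes>\<^bsub>G\<^esub> h) j"
      using h by simp
  qed (use a H g im config_closed[OF act_closed[OF b H(2) c]] in \<open>auto simp: subset_iff intro!: F.finsum_closed\<close>)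
  also have "\<dots> = act H a (act H b c) g i" using g im by (simp add: act_def)
  finally show ?thesis by simp
qed

theorem directly_finite_of_surjunctive:
  assumes S: "surjunctive G" and fin: "finite (carrier F)"
  shows "directly_finite M"
  unfolding directly_finite_def
proof (intro ballI impI)
  fix a b assume a: "a \<in> carrier M" and b: "b \<in> carrier M" and ab: "a \<otimes>\<^bsub>M\<^esub> b = \<one>\<^bsub>M\<^esub>"
  obtain Ha where Ha: "finite Ha" "Ha \<subseteq> carrier G" "supported Ha a" by (rule ex_support[OF a])
  obtain Hb where Hb: "finite Hb" "Hb \<subseteq> carrier G" "supported Hb b" by (rule ex_support[OF b])
  define H where "H = Ha \<union> Hb"
  have H: "finite H" "H \<subseteq> carrier G" "supported H a" "supported H b"
    using Ha Hb by (auto simp: H_def intro: supported_mono)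
  (* Besides the products of elements of H, the window contains the neutral element, where the value
     at g itself is stored, and the inverse of g, where a delta configuration has its only nonzero
     value. *)
  define W where "W g = insert \<one>\<^bsub>G\<^esub> (insert (inv\<^bsub>G\<^esub> g) ((\<lambda>(h, h'). h \<otimes>\<^bsub>G\<^esub> h') ` (H \<times> H)))" for g
  have W: "finite (W g)" "\<And>h h'. h \<in> H \<Longrightarrow> h' \<in> H \<Longrightarrow> h \<otimes>\<^bsub>G\<^esub> h' \<in> W g" for g
    using H by (auto simp: W_def)
  have acts: "act H u c \<in> configs G vectors" if "u \<in> carrier M" "c \<in> configs G vectors" for u c
    using act_closed[OF that(1) H(2) that(2)] .
  have left_inverse: "act H a (act H b c) = c" if c: "c \<in> configs G vectors" for c
  proof (rule config_eqI)
    fix g i assume g: "g \<in> carrier G" and i: "i < n"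
    have "act H a (act H b c) g i = window c g (W g) (i, i) \<one>\<^bsub>G\<^esub>"
      using act_act_entry[OF a b H c g W i i] window_closed[OF c g W(1)] by (simp add: ab)
    also have "\<dots> = c g i" using g i by (simp add: window_def W_def)
    finally show "act H a (act H b c) g i = c g i" .
  qed (use a b c acts in auto)
  have "finite vectors" using fin by (intro finite_PiE) auto
  moreover have "inj_on (act H b) (configs G vectors)"
    by (rule inj_on_inverseI[of _ "act H a"], rule left_inverse)
  ultimately have surj: "act H b ` configs G vectors = configs G vectors"
    by (intro surjunctive_alphabet[OF G.group_axioms S _ act_cellular_automaton[OF b H(1,2)]])
  have right_inverse: "act H b (act H a c) = c" if c: "c \<in> configs G vectors" for c
  proof -
    obtain d where "d \<in> configs G vectors" "c = act H b d" using surj c by blast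
    then show ?thesis using left_inverse by simp
  qed
  show "b \<otimes>\<^bsub>M\<^esub> a = \<one>\<^bsub>M\<^esub>"
  proof (rule matrix_eqI)
    fix i j g assume i: "i < n" and j: "j < n" and g: "g \<in> carrier G"
    (* The action is faithful: applied to the delta configuration at the neutral element with value
       the j-th unit vector, a matrix yields at the inverse of g its coefficients at g in column j. *)
    define c where "c = (\<lambda>h\<in>carrier G. \<lambda>l\<in>{..<n}. if h = \<one>\<^bsub>G\<^esub> \<and> l = j then \<one>\<^bsub>F\<^esub> else \<zero>\<^bsub>F\<^esub>)"
    have c: "c \<in> configs G vectors" by (auto simp: c_def configs_def)
    let ?g = "inv\<^bsub>G\<^esub> g"
    have g': "?g \<in> carrier G" using g by simp
    let ?x = "window c ?g (W ?g)"
    have x: "?x \<in> carrier M" by (rule window_closed[OF c g' W(1)])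
    obtain K where K: "finite K" "K \<subseteq> carrier G" "supported K (b \<otimes>\<^bsub>M\<^esub> a)"
      using ex_support a b by (metis MR.m_closed)
    define L where "L = insert g K"
    have L: "finite L" "L \<subseteq> carrier G" "supported L (b \<otimes>\<^bsub>M\<^esub> a)"
      using K g by (auto simp: L_def intro: supported_mono)
    have x_entry: "?x (l, i) (inv\<^bsub>G\<^esub> h) = (if h = g \<and> l = j then \<one>\<^bsub>F\<^esub> else \<zero>\<^bsub>F\<^esub>)"
      if "l < n" "h \<in> carrier G" for l h
    proof -
      have "?g \<otimes>\<^bsub>G\<^esub> h = \<one>\<^bsub>G\<^esub> \<longleftrightarrow> h = g"
        using g that(2) by (metis G.inv_closed G.inv_equality G.inv_inv G.l_inv)
      then show ?thesis using that i g by (auto simp: window_def c_def W_def)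
    qed
    have "c ?g i = act H b (act H a c) ?g i" by (simp add: right_inverse[OF c])
    also have "\<dots> = ((b \<otimes>\<^bsub>M\<^esub> a) \<otimes>\<^bsub>M\<^esub> ?x) (i, i) \<one>\<^bsub>G\<^esub>"
      by (rule act_act_entry[OF b a H(1,2,4,3) c g' W i i])
    also have "\<dots> = (\<Oplus>\<^bsub>F\<^esub>l\<in>{..<n}. \<Oplus>\<^bsub>F\<^esub>h\<in>L. (b \<otimes>\<^bsub>M\<^esub> a) (i, l) h \<otimes>\<^bsub>F\<^esub> ?x (l, i) (inv\<^bsub>G\<^esub> h \<otimes>\<^bsub>G\<^esub> \<one>\<^bsub>G\<^esub>))"
      using a b x L i by (intro mult_entry) auto
    also have "\<dots> = (b \<otimes>\<^bsub>M\<^esub> a) (i, j) g"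
    proof (rule F.finsum_delta[where i = j])
      have ba: "b \<otimes>\<^bsub>M\<^esub> a \<in> carrier M" using a b by simp
      fix l assume "l \<in> {..<n}"
      then have l: "l < n" by simp
      have "(\<Oplus>\<^bsub>F\<^esub>h\<in>L. (b \<otimes>\<^bsub>M\<^esub> a) (i, l) h \<otimes>\<^bsub>F\<^esub> ?x (l, i) (inv\<^bsub>G\<^esub> h \<otimes>\<^bsub>G\<^esub> \<one>\<^bsub>G\<^esub>))
          = (if l = j then (b \<otimes>\<^bsub>M\<^esub> a) (i, j) g else \<zero>\<^bsub>F\<^esub>)"
      proof (rule F.finsum_delta[where i = g])
        fix h assume "h \<in> L"
        then have h: "h \<in> carrier G" using L by auto
        show "(b \<otimes>\<^bsub>M\<^esub> a) (i, l) h \<otimes>\<^bsub>F\<^esub> ?x (l, i) (inv\<^bsub>G\<^esub> h \<otimes>\<^bsub>G\<^esub> \<one>\<^bsub>G\<^esub>)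
            = (if h = g then if l = j then (b \<otimes>\<^bsub>M\<^esub> a) (i, j) g else \<zero>\<^bsub>F\<^esub> else \<zero>\<^bsub>F\<^esub>)"
          using entry_closed[OF ba i l h] entry_closed[OF ba i j g] h by (auto simp: x_entry[OF l h])
      qed (use L entry_closed[OF ba i j g] in \<open>auto simp: L_def\<close>)
      then show "(\<Oplus>\<^bsub>F\<^esub>h\<in>L. (b \<otimes>\<^bsub>M\<^esub> a) (i, l) h \<otimes>\<^bsub>F\<^esub> ?x (l, i) (inv\<^bsub>G\<^esub> h \<otimes>\<^bsub>G\<^esub> \<one>\<^bsub>G\<^esub>))
          = (if l = j then (b \<otimes>\<^bsub>M\<^esub> a) (i, j) g else \<zero>\<^bsub>F\<^esub>)" .
    qed (use a b i j g in auto)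
    finally have "(b \<otimes>\<^bsub>M\<^esub> a) (i, j) g = c ?g i" by simp
    also have "\<dots> = \<one>\<^bsub>M\<^esub> (i, j) g"
      using i j g by (auto simp: c_def one_entry)
    finally show "(b \<otimes>\<^bsub>M\<^esub> a) (i, j) g = \<one>\<^bsub>M\<^esub> (i, j) g" .
  qed (use a b in auto)
qed

end

section \<open>Reduction of the coefficients\<close>

text \<open>
  The sums of a product in the group ring are formed in the ambient ring, while the specialization is
  defined on a subring only.
\<close>

lemma (in abelian_monoid) hom_finsum_partial:
  assumes A: "abelian_monoid A'" and C: "\<zero> \<in> C" "C \<subseteq> carrier G"
    and closed: "\<And>x y. x \<in> C \<Longrightarrow> y \<in> C \<Longrightarrow> x \<oplus> y \<in> C"
    and \<phi>: "\<phi> \<zero> = \<zero>\<^bsub>A'\<^esub>" "\<And>x. x \<in> C \<Longrightarrow> \<phi> x \<in> carrier A'"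
      "\<And>x y. x \<in> C \<Longrightarrow> y \<in> C \<Longrightarrow> \<phi> (x \<oplus> y) = \<phi> x \<oplus>\<^bsub>A'\<^esub> \<phi> y"
    and "finite I" "\<And>i. i \<in> I \<Longrightarrow> f i \<in> C"
  shows "(\<Oplus>i\<in>I. f i) \<in> C \<and> \<phi> (\<Oplus>i\<in>I. f i) = (\<Oplus>\<^bsub>A'\<^esub>i\<in>I. \<phi> (f i))"
  using assms(8,9)
proof (induction I)
  case empty
  interpret A: abelian_monoid A' by (rule A)
  show ?case using C(1) \<phi>(1) by simp
next
  case (insert i I)
  interpret A: abelian_monoid A' by (rule A)
  have f: "f j \<in> C" "f j \<in> carrier G" if "j \<in> insert i I" for j using insert.prems[OF that] C(2) by auto
  have "(\<Oplus>j\<in>insert i I. f j) = f i \<oplus> (\<Oplus>j\<in>I. f j)" using insert.hyps f by (intro finsum_insert) auto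
  moreover have "(\<Oplus>\<^bsub>A'\<^esub>j\<in>insert i I. \<phi> (f j)) = \<phi> (f i) \<oplus>\<^bsub>A'\<^esub> (\<Oplus>\<^bsub>A'\<^esub>j\<in>I. \<phi> (f j))"
    using insert.hyps f \<phi>(2) by (intro A.finsum_insert) auto
  ultimately show ?case using insert f closed \<phi>(3) by simp
qed

definition coefficients :: "nat \<Rightarrow> ('g, 'm) monoid_scheme \<Rightarrow> (nat \<times> nat \<Rightarrow> 'g \<Rightarrow> 'a) \<Rightarrow> 'a set" where
  "coefficients n G a = {a (i, j) g | i j g. i < n \<and> j < n \<and> g \<in> carrier G}"

definition coefficientwise ::
    "nat \<Rightarrow> ('g, 'm) monoid_scheme \<Rightarrow> ('a \<Rightarrow> 'b) \<Rightarrow> (nat \<times> nat \<Rightarrow> 'g \<Rightarrow> 'a) \<Rightarrow> nat \<times> nat \<Rightarrow> 'g \<Rightarrow> 'b"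
  where "coefficientwise n G \<phi> a = (\<lambda>(i, j)\<in>{..<n} \<times> {..<n}. \<lambda>g\<in>carrier G. \<phi> (a (i, j) g))"

text \<open>
  A product of matrices is a finite sum of products of coefficients, so applying a homomorphism to the
  coefficients is compatible with multiplication.
\<close>

lemma coefficientwise_mult:
  fixes K :: "('k, 'm) ring_scheme" and F :: "('f, 'q) ring_scheme" and G :: "('g, 'r) monoid_scheme"
  assumes K: "ring K" and F: "ring F" and G: "group G"
    and C: "subring C K" and \<phi>: "\<phi> \<in> ring_hom (K\<lparr>carrier := C\<rparr>) F"
    and a: "a \<in> carrier (mat_ring n (group_ring K G))" and b: "b \<in> carrier (mat_ring n (group_ring K G))"
    and coefs: "coefficients n G a \<subseteq> C" "coefficients n G b \<subseteq> C"
  shows "coefficientwise n G \<phi> a \<in> carrier (mat_ring n (group_ring F G))"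
    and "\<lbrakk>i < n; j < n; g \<in> carrier G\<rbrakk> \<Longrightarrow> (a \<otimes>\<^bsub>mat_ring n (group_ring K G)\<^esub> b) (i, j) g \<in> C"
    and "\<lbrakk>i < n; j < n; g \<in> carrier G\<rbrakk> \<Longrightarrow>
      (coefficientwise n G \<phi> a \<otimes>\<^bsub>mat_ring n (group_ring F G)\<^esub> coefficientwise n G \<phi> b) (i, j) g
        = \<phi> ((a \<otimes>\<^bsub>mat_ring n (group_ring K G)\<^esub> b) (i, j) g)"
proof -
  interpret K: ring K by (rule K)
  interpret F: ring F by (rule F)
  interpret G: group G by (rule G)
  interpret MK: matrix_group_ring K G n ..
  interpret MF: matrix_group_ring F G n ..
  note Csub = subringE[OF C]
  have aC: "a (i, j) g \<in> C" and bC: "b (i, j) g \<in> C" if "i < n" "j < n" "g \<in> carrier G" for i j g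
    using coefs that unfolding coefficients_def by blast+
  have \<phi>_closed: "\<phi> x \<in> carrier F" if "x \<in> C" for x
    using ring_hom_memE(1)[OF \<phi>] that by auto
  have hom: "\<phi> (x \<otimes>\<^bsub>K\<^esub> y) = \<phi> x \<otimes>\<^bsub>F\<^esub> \<phi> y" "\<phi> (x \<oplus>\<^bsub>K\<^esub> y) = \<phi> x \<oplus>\<^bsub>F\<^esub> \<phi> y"
    if "x \<in> C" "y \<in> C" for x y using ring_hom_memE(2,3)[OF \<phi>] that by auto
  have zero: "\<phi> \<zero>\<^bsub>K\<^esub> = \<zero>\<^bsub>F\<^esub>"
    using ring_hom_zero[OF \<phi> K.subring_is_ring[OF C] F] by simp
  let ?m = "coefficientwise n G \<phi>"
  obtain H where H: "finite H" "H \<subseteq> carrier G" "MK.supported H a" by (rule MK.ex_support[OF a])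
  have map_closed: "?m u \<in> carrier MF.M"
    if u: "u \<in> carrier MK.M" and uC: "\<And>i j g. \<lbrakk>i < n; j < n; g \<in> carrier G\<rbrakk> \<Longrightarrow> u (i, j) g \<in> C" for u
  proof -
    obtain L where L: "finite L" "L \<subseteq> carrier G" "MK.supported L u" by (rule MK.ex_support[OF u])
    show ?thesis
      unfolding coefficientwise_def
      by (rule MF.matrixI[OF L(1)]) (use uC \<phi>_closed zero MK.supportedD[OF L(3)] in auto)
  qed
  show ma: "?m a \<in> carrier MF.M" by (rule map_closed[OF a aC])
  have mb: "?m b \<in> carrier MF.M" by (rule map_closed[OF b bC])
  have supp: "MF.supported H (?m a)"
    using MK.supportedD[OF H(3)] zero
    by (force simp: MF.supported_def coefficientwise_def gsupp_def)
  note sum = K.hom_finsum_partial[where \<phi> = \<phi> and A' = F,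
      OF F.abelian_monoid_axioms Csub(2,1) Csub(7) zero \<phi>_closed hom(2)]
  show "(a \<otimes>\<^bsub>MK.M\<^esub> b) (i, j) g \<in> C" 
    and "(?m a \<otimes>\<^bsub>MF.M\<^esub> ?m b) (i, j) g = \<phi> ((a \<otimes>\<^bsub>MK.M\<^esub> b) (i, j) g)"
    if ij: "i < n" "j < n" and g: "g \<in> carrier G" for i j g
  proof -
    let ?t = "\<lambda>l h. a (i, l) h \<otimes>\<^bsub>K\<^esub> b (l, j) (inv\<^bsub>G\<^esub> h \<otimes>\<^bsub>G\<^esub> g)"
    have t: "?t l h \<in> C" "\<phi> (?t l h) = ?m a (i, l) h \<otimes>\<^bsub>F\<^esub> ?m b (l, j) (inv\<^bsub>G\<^esub> h \<otimes>\<^bsub>G\<^esub> g)"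
      if "l < n" "h \<in> H" for l h
    proof -
      have h: "h \<in> carrier G" "inv\<^bsub>G\<^esub> h \<otimes>\<^bsub>G\<^esub> g \<in> carrier G" using H(2) that(2) g by auto
      note c = aC[OF ij(1) that(1) h(1)] bC[OF that(1) ij(2) h(2)]
      show "?t l h \<in> C" using c by (rule Csub(6))
      show "\<phi> (?t l h) = ?m a (i, l) h \<otimes>\<^bsub>F\<^esub> ?m b (l, j) (inv\<^bsub>G\<^esub> h \<otimes>\<^bsub>G\<^esub> g)"
        using that(1) ij h hom(1)[OF c] by (simp add: coefficientwise_def)
    qed
    have inner: "(\<Oplus>\<^bsub>K\<^esub>h\<in>H. ?t l h) \<in> C \<and> \<phi> (\<Oplus>\<^bsub>K\<^esub>h\<in>H. ?t l h) = (\<Oplus>\<^bsub>F\<^esub>h\<in>H. \<phi> (?t l h))"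
      if "l < n" for l
      by (rule sum) (use t that H(1) in auto)
    have outer: "(\<Oplus>\<^bsub>K\<^esub>l\<in>{..<n}. \<Oplus>\<^bsub>K\<^esub>h\<in>H. ?t l h) \<in> C \<and>
        \<phi> (\<Oplus>\<^bsub>K\<^esub>l\<in>{..<n}. \<Oplus>\<^bsub>K\<^esub>h\<in>H. ?t l h) = (\<Oplus>\<^bsub>F\<^esub>l\<in>{..<n}. \<phi> (\<Oplus>\<^bsub>K\<^esub>h\<in>H. ?t l h))"
      by (rule sum) (use inner in auto)
    have prod: "(a \<otimes>\<^bsub>MK.M\<^esub> b) (i, j) g = (\<Oplus>\<^bsub>K\<^esub>l\<in>{..<n}. \<Oplus>\<^bsub>K\<^esub>h\<in>H. ?t l h)"
      by (rule MK.mult_entry[OF a b H ij g])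
    show "(a \<otimes>\<^bsub>MK.M\<^esub> b) (i, j) g \<in> C" using outer prod by simp
    have "(?m a \<otimes>\<^bsub>MF.M\<^esub> ?m b) (i, j) g = (\<Oplus>\<^bsub>F\<^esub>l\<in>{..<n}. \<Oplus>\<^bsub>F\<^esub>h\<in>H.
        ?m a (i, l) h \<otimes>\<^bsub>F\<^esub> ?m b (l, j) (inv\<^bsub>G\<^esub> h \<otimes>\<^bsub>G\<^esub> g))"
      by (rule MF.mult_entry[OF ma mb H(1,2) supp ij g])
    also have "\<dots> = (\<Oplus>\<^bsub>F\<^esub>l\<in>{..<n}. \<Oplus>\<^bsub>F\<^esub>h\<in>H. \<phi> (?t l h))"
      by (intro F.finsum_cong' refl)
        (auto simp: \<phi>_closed t(1) simp flip: t(2) intro!: F.finsum_closed)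
    also have "\<dots> = (\<Oplus>\<^bsub>F\<^esub>l\<in>{..<n}. \<phi> (\<Oplus>\<^bsub>K\<^esub>h\<in>H. ?t l h))"
      using inner \<phi>_closed by (intro F.finsum_cong' refl) auto
    finally show "(?m a \<otimes>\<^bsub>MF.M\<^esub> ?m b) (i, j) g = \<phi> ((a \<otimes>\<^bsub>MK.M\<^esub> b) (i, j) g)"
      using outer prod by simp
  qed
qed

theorem directly_finite_mat_group_ring:
  fixes G :: "('g, 'r) monoid_scheme" and k :: "('k, 'm) ring_scheme"
  assumes G: "group G" and S: "surjunctive G" and k: "domain k"
  shows "directly_finite (mat_ring n (group_ring k G))"
proof -
  interpret k: domain k by (rule k)
  interpret G: group G by (rule G)
  interpret K: matrix_group_ring k G n ..
  show ?thesis
    unfolding directly_finite_def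
  proof (intro ballI impI)
    fix a b assume a: "a \<in> carrier K.M" and b: "b \<in> carrier K.M" and ab: "a \<otimes>\<^bsub>K.M\<^esub> b = \<one>\<^bsub>K.M\<^esub>"
    have fin: "finite (coefficients n G u)" "coefficients n G u \<subseteq> carrier k" if u: "u \<in> carrier K.M" for u
    proof -
      obtain H where H: "finite H" "H \<subseteq> carrier G" "K.supported H u" by (rule K.ex_support[OF u])
      have "coefficients n G u \<subseteq> insert \<zero>\<^bsub>k\<^esub> ((\<lambda>(i, j, h). u (i, j) h) ` ({..<n} \<times> {..<n} \<times> H))"
        using K.supportedD[OF H(3)] by (force simp: coefficients_def)
      then show "finite (coefficients n G u)" by (rule finite_subset) (use H(1) in auto)
      show "coefficients n G u \<subseteq> carrier k" using u by (auto simp: coefficients_def)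
    qed
    obtain C where C: "subring C k" "finitely_specializable (k\<lparr>carrier := C\<rparr>)" and sub: "coefficients n G a \<subseteq> C" "coefficients n G b \<subseteq> C"
      using k.finite_subset_in_specializable_subring[of "coefficients n G a \<union> coefficients n G b"] fin[OF a] fin[OF b] by (metis finite_UnI le_sup_iff)
    note Csub = subringE[OF C(1)]
    show "b \<otimes>\<^bsub>K.M\<^esub> a = \<one>\<^bsub>K.M\<^esub>"
    proof (rule K.matrix_eqI)
      fix i j g assume i: "i < n" and j: "j < n" and g: "g \<in> carrier G"
      let ?x = "(b \<otimes>\<^bsub>K.M\<^esub> a) (i, j) g" and ?y = "\<one>\<^bsub>K.M\<^esub> (i, j) g"
      show "?x = ?y"
      proof (rule ccontr)
        assume neq: "?x \<noteq> ?y"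
        have "id \<in> ring_hom (k\<lparr>carrier := C\<rparr>) k"
          using Csub(1) by (intro ring_hom_memI) auto
        then have x: "?x \<in> C"
          by (rule coefficientwise_mult(2)[OF k.ring_axioms k.ring_axioms G C(1) _ b a sub(2,1) i j g])
        have y: "?y \<in> C" using i j g Csub(2,3) by (simp add: K.one_entry)
        have xy: "?x \<in> carrier k" "?y \<in> carrier k" using x y Csub(1) by auto
        have diff: "?x \<ominus>\<^bsub>k\<^esub> ?y \<in> C" using x y Csub(5,7) by (simp add: a_minus_def)
        then have "?x \<ominus>\<^bsub>k\<^esub> ?y \<in> carrier (k\<lparr>carrier := C\<rparr>) - {\<zero>\<^bsub>k\<lparr>carrier := C\<rparr>\<^esub>}"
          using neq xy by (simp add: k.r_right_minus_eq)
        then obtain F :: "nat ring" and \<phi> where F: "cring F" "finite (carrier F)" "\<one>\<^bsub>F\<^esub> \<noteq> \<zero>\<^bsub>F\<^esub>"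
          and \<phi>: "\<phi> \<in> ring_hom (k\<lparr>carrier := C\<rparr>) F" "\<phi> (?x \<ominus>\<^bsub>k\<^esub> ?y) \<in> Units F"
          using C(2) unfolding finitely_specializable_def by blast
        interpret F: cring F by (rule F)
        interpret MF: matrix_group_ring F G n ..
        let ?m = "coefficientwise n G \<phi>"
        have \<phi>01: "\<phi> \<zero>\<^bsub>k\<^esub> = \<zero>\<^bsub>F\<^esub>" "\<phi> \<one>\<^bsub>k\<^esub> = \<one>\<^bsub>F\<^esub>"
          using ring_hom_zero[OF \<phi>(1) k.subring_is_ring[OF C(1)] F.ring_axioms] ring_hom_one[OF \<phi>(1)] by auto
        have \<phi>_one: "\<phi> (\<one>\<^bsub>K.M\<^esub> (p, q) h) = \<one>\<^bsub>MF.M\<^esub> (p, q) h" if "p < n" "q < n" "h \<in> carrier G" for p q h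
          using that by (simp add: K.one_entry MF.one_entry \<phi>01)
        note ma = coefficientwise_mult[OF k.ring_axioms F.ring_axioms G C(1) \<phi>(1) a b sub]
        note mb = coefficientwise_mult[OF k.ring_axioms F.ring_axioms G C(1) \<phi>(1) b a sub(2,1)]
        have "?m a \<otimes>\<^bsub>MF.M\<^esub> ?m b = \<one>\<^bsub>MF.M\<^esub>"
          by (rule MF.matrix_eqI) (use ma mb in \<open>simp_all add: ab \<phi>_one\<close>)
        then have "?m b \<otimes>\<^bsub>MF.M\<^esub> ?m a = \<one>\<^bsub>MF.M\<^esub>"
          using MF.directly_finite_of_surjunctive[OF S F(2)] ma(1) mb(1) unfolding directly_finite_def by blast
        then have eq: "\<phi> ?x = \<phi> ?y" using mb(3)[OF i j g] \<phi>_one[OF i j g] by simp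
        have "\<phi> ?x = \<phi> ((?x \<ominus>\<^bsub>k\<^esub> ?y) \<oplus>\<^bsub>k\<^esub> ?y)" using xy by (simp add: k.minus_eq k.a_assoc k.l_neg)
        also have "\<dots> = \<phi> (?x \<ominus>\<^bsub>k\<^esub> ?y) \<oplus>\<^bsub>F\<^esub> \<phi> ?y"
          using ring_hom_memE(3)[OF \<phi>(1), of "?x \<ominus>\<^bsub>k\<^esub> ?y" ?y] y diff by simp
        finally have "\<phi> (?x \<ominus>\<^bsub>k\<^esub> ?y) = \<zero>\<^bsub>F\<^esub>"
          using eq ring_hom_memE(1)[OF \<phi>(1), of ?y] y \<phi>(2) F.Units_closed F.add.r_cancel_one by auto
        then show False using \<phi>(2) F(3) by (metis F.Units_l_inv_ex F.r_null)
      qed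
    qed (use a b in auto)
  qed
qed

theorem theoremB:
  shows "(\<forall>(G :: 'g monoid) (k :: 'k ring). group G \<and> surjunctive G \<and> field k \<longrightarrow>
            (\<forall>n\<ge>1. directly_finite (mat_ring n (group_ring k G))))
       \<and> ((\<forall>G :: 'g monoid. group G \<longrightarrow> surjunctive G) \<longrightarrow>
            (\<forall>(G :: 'g monoid) (k :: 'k ring). group G \<and> field k \<longrightarrow>
               (\<forall>n\<ge>1. directly_finite (mat_ring n (group_ring k G)))))"
  using directly_finite_mat_group_ring field.axioms(1) by blast

end
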